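(* Let $n\ge 3$ and let $\mathbb{F}$ be an arbitrary infinite field. Then $\mathfrak{d}_n$ together with the family $\{\mathfrak{e}_n(\alpha):\ \alpha\in\mathbb{F}\}$ give a complete list of non-isomorphic elements of $\mathcal{A}_n(\mathbb{F})\setminus\mathcal{K}_n^a(\mathbb{F})$ which have $\mathfrak{a}_n$ as their only proper degeneration. That is: $\mathfrak{d}_n$ and the $\mathfrak{e}_n(\alpha)$, $\alpha\in\mathbb{F}$, are pairwise non-isomorphic elements of $\mathcal{A}_n(\mathbb{F})\setminus\mathcal{K}_n^a(\mathbb{F})$; each of them has $\mathfrak{a}_n$ as its only proper degeneration; and every element of $\mathcal{A}_n(\mathbb{F})\setminus\mathcal{K}_n^a(\mathbb{F})$ which has $\mathfrak{a}_n$ as its only proper degeneration is isomorphic to one of them.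
   Context: Let $V$ be a fixed $n$-dimensional $\mathbb{F}$-vector space with a fixed ordered basis $(v_1^*,\ldots,v_n^* )$. $\mathcal{A}_n(\mathbb{F})$ is the set of all algebra structures on $V$, i.e. $\mathbb{F}$-algebras $(V,[\,,])$ with $[\,,]:V\times V\to V$ an arbitrary $\mathbb{F}$-bilinear map. $\mathcal{K}_n^a(\mathbb{F})\subseteq\mathcal{A}_n(\mathbb{F})$ is the set of those satisfying $[x,x]=0_V$ for all $x\in V$. Structure vectors: the structure vector of an algebra $\mathfrak{g}$ relative to an ordered basis $(b_1,\ldots,b_n)$ is $(\alpha_{ijk})_{1\le i,j,k\le n}\in\mathbb{F}^{n^3}$, where $[b_i,b_j]=\sum_{k=1}^n\alpha_{ijk}b_k$. A structure vector of $\mathfrak{g}$ is its structure vector relative to some ordered basis. Action: $G=\mathrm{GL}(n,\mathbb{F})$ acts on the right on $\mathbb{F}^{n^3}$ by change of basis: if $\boldsymbol\lambda$ is the structure vector of an algebra structure relative to $(v_i^* )$ and $g=(g_{ij})\in G$, then $\boldsymbol\lambda g$ is the structure vector of the same algebra relative to the basis $v_j=\sum_i g_{ij}v_i^*$. $O(\boldsymbol\lambda)$ denotes the orbit of $\boldsymbol\lambda$, and $\overline{Y}$ denotes the closure of $Y\subseteq\mathbb{F}^{n^3}$ in the Zariski topology, whose closed sets are the common zero sets in $\mathbb{F}^{n^3}$ of sets of polynomials over $\mathbb{F}$ in $n^3$ indeterminates. Degeneration: $\mathfrak{g}_1$ degenerates (respectively, properly degenerates) to $\mathfrak{g}_2$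 if there are structure vectors $\boldsymbol\lambda_1$ of $\mathfrak{g}_1$ and $\boldsymbol\lambda_2$ of $\mathfrak{g}_2$ with $\boldsymbol\lambda_2\in\overline{O(\boldsymbol\lambda_1)}$ (respectively, $\boldsymbol\lambda_2\in\overline{O(\boldsymbol\lambda_1)}\setminus O(\boldsymbol\lambda_1)$). "$\mathfrak{g}$ has $\mathfrak{a}_n$ as its only proper degeneration" means that the algebras to which $\mathfrak{g}$ properly degenerates are, up to isomorphism, exactly $\mathfrak{a}_n$. Particular algebras: $\mathfrak{a}_n$ has all products zero. $\mathfrak{d}_n\in\mathcal{A}_n(\mathbb{F})$ has, relative to $(v_i^* )$, the structure vector $\boldsymbol\delta_n=(\delta_{ijk})$ with $\delta_{112}=1$ and all other $\delta_{ijk}=0$. For $\alpha\in\mathbb{F}$, $\mathfrak{e}_n(\alpha)\in\mathcal{A}_n(\mathbb{F})$ has, relative to $(v_i^* )$, the structure vector $\boldsymbol\varepsilon_n(\alpha)=(\varepsilon_{ijk}(\alpha))$ with $\varepsilon_{111}(\alpha)=1$, $\varepsilon_{1ii}(\alpha)=\alpha$ and $\varepsilon_{i1i}(\alpha)=1-\alpha$ for $2\le i\le n$, and all other $\varepsilon_{ijk}(\alpha)=0$. *)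

theory Defs
  imports "HOL-Analysis.Analysis" "HOL-Library.Poly_Mapping"
begin

section \<open>Algebra structures on a vector space\<close>

text \<open>
  The vector space \<open>V\<close> is the type \<open>'v\<close> with scalar multiplication \<open>s\<close> over the field \<open>'f\<close>.
  An algebra structure on \<open>V\<close> is identified with its product.
  Bases are families indexed by a finite linearly ordered type \<open>'n\<close>, so \<open>n = CARD('n)\<close>.
\<close>

definition ordered_basis ::
  "('f::field \<Rightarrow> 'v::ab_group_add \<Rightarrow> 'v) \<Rightarrow> ('n::finite \<Rightarrow> 'v) \<Rightarrow> bool" where
  "ordered_basis s b \<longleftrightarrow>
     inj b \<and> \<not> module.dependent s (range b) \<and> module.span s (range b) = UNIV"

definition algebras ::
  "('f::field \<Rightarrow> 'v::ab_group_add \<Rightarrow> 'v) \<Rightarrow> ('v \<Rightarrow> 'v \<Rightarrow> 'v) set" where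
  "algebras s = {m. (\<forall>x. Vector_Spaces.linear s s (\<lambda>y. m x y)) \<and>
                    (\<forall>y. Vector_Spaces.linear s s (\<lambda>x. m x y))}"

definition alternating_algebras ::
  "('f::field \<Rightarrow> 'v::ab_group_add \<Rightarrow> 'v) \<Rightarrow> ('v \<Rightarrow> 'v \<Rightarrow> 'v) set" where
  "alternating_algebras s = {m \<in> algebras s. \<forall>x. m x x = 0}"

definition isomorphic ::
  "('f::field \<Rightarrow> 'v::ab_group_add \<Rightarrow> 'v) \<Rightarrow> ('v \<Rightarrow> 'v \<Rightarrow> 'v) \<Rightarrow> ('v \<Rightarrow> 'v \<Rightarrow> 'v) \<Rightarrow> bool" where
  "isomorphic s m1 m2 \<longleftrightarrow>
     (\<exists>\<phi>. Vector_Spaces.linear s s \<phi> \<and> bij \<phi> \<and> (\<forall>x y. \<phi> (m1 x y) = m2 (\<phi> x) (\<phi> y)))"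


section \<open>Structure vectors and change of basis\<close>

text \<open>A point of \<open>\<bbbF>\<^bsup>n^3\<^esup>\<close>; the entry with indices \<open>ijk\<close> is the value at \<open>(i, j, k)\<close>.\<close>

type_synonym ('f, 'n) svec = "'n \<times> 'n \<times> 'n \<Rightarrow> 'f"

definition coord ::
  "('f::field \<Rightarrow> 'v::ab_group_add \<Rightarrow> 'v) \<Rightarrow> ('n::finite \<Rightarrow> 'v) \<Rightarrow> 'v \<Rightarrow> 'n \<Rightarrow> 'f" where
  "coord s b x i = module.representation s (range b) x (b i)"

definition structure_vector ::
  "('f::field \<Rightarrow> 'v::ab_group_add \<Rightarrow> 'v) \<Rightarrow> ('n::finite \<Rightarrow> 'v) \<Rightarrow> ('v \<Rightarrow> 'v \<Rightarrow> 'v) \<Rightarrow> ('f, 'n) svec"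
  where
  "structure_vector s b m = (\<lambda>(i, j, k). coord s b (m (b i) (b j)) k)"

definition algebra_of ::
  "('f::field \<Rightarrow> 'v::ab_group_add \<Rightarrow> 'v) \<Rightarrow> ('n::finite \<Rightarrow> 'v) \<Rightarrow> ('f, 'n) svec \<Rightarrow> ('v \<Rightarrow> 'v \<Rightarrow> 'v)"
  where
  "algebra_of s b l =
     (\<lambda>x y. \<Sum>i\<in>UNIV. \<Sum>j\<in>UNIV. \<Sum>k\<in>UNIV. s (coord s b x i * coord s b y j * l (i, j, k)) (b k))"

text \<open>Right action of \<open>GL(n, \<bbbF>)\<close>, relative to the fixed ordered basis \<open>v\<close> of \<open>V\<close>.\<close>

definition act ::
  "('f::field \<Rightarrow> 'v::ab_group_add \<Rightarrow> 'v) \<Rightarrow> ('n::finite \<Rightarrow> 'v) \<Rightarrow> ('f, 'n) svec \<Rightarrow> 'f^'n^'n \<Rightarrow>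
   ('f, 'n) svec" where
  "act s v l g = structure_vector s (\<lambda>j. \<Sum>i\<in>UNIV. s (g $ i $ j) (v i)) (algebra_of s v l)"

definition orbit ::
  "('f::field \<Rightarrow> 'v::ab_group_add \<Rightarrow> 'v) \<Rightarrow> ('n::finite \<Rightarrow> 'v) \<Rightarrow> ('f, 'n) svec \<Rightarrow> ('f, 'n) svec set"
  where
  "orbit s v l = {act s v l g | g. invertible g}"


section \<open>Zariski topology\<close>

text \<open>
  Polynomials with indeterminates indexed by \<open>'i\<close> are finitely supported maps from monomials
  to coefficients, a monomial being a finitely supported map from indeterminates to exponents.
\<close>

type_synonym ('i, 'f) mvpoly = "('i \<Rightarrow>\<^sub>0 nat) \<Rightarrow>\<^sub>0 'f"

definition poly_eval :: "('i, 'f::comm_semiring_1) mvpoly \<Rightarrow> ('i \<Rightarrow> 'f) \<Rightarrow> 'f" where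
  "poly_eval p x =
     (\<Sum>t\<in>Poly_Mapping.keys p.
        Poly_Mapping.lookup p t * (\<Prod>i\<in>Poly_Mapping.keys t. x i ^ Poly_Mapping.lookup t i))"

definition zariski_closed :: "('i \<Rightarrow> 'f::field) set \<Rightarrow> bool" where
  "zariski_closed Z \<longleftrightarrow> (\<exists>P :: ('i, 'f) mvpoly set. Z = {x. \<forall>p\<in>P. poly_eval p x = 0})"

definition zariski_closure :: "('i \<Rightarrow> 'f::field) set \<Rightarrow> ('i \<Rightarrow> 'f) set" where
  "zariski_closure Y = zariski_closed hull Y"


section \<open>Degenerations\<close>

definition structure_vectors ::
  "('f::field \<Rightarrow> 'v::ab_group_add \<Rightarrow> 'v) \<Rightarrow> ('v \<Rightarrow> 'v \<Rightarrow> 'v) \<Rightarrow> ('f, 'n::finite) svec set" where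
  "structure_vectors s m = {structure_vector s b m | b. ordered_basis s b}"

definition properly_degenerates ::
  "('f::field \<Rightarrow> 'v::ab_group_add \<Rightarrow> 'v) \<Rightarrow> ('n::finite \<Rightarrow> 'v) \<Rightarrow>
   ('v \<Rightarrow> 'v \<Rightarrow> 'v) \<Rightarrow> ('v \<Rightarrow> 'v \<Rightarrow> 'v) \<Rightarrow> bool" where
  "properly_degenerates s v m1 m2 \<longleftrightarrow>
     (\<exists>l1\<in>structure_vectors s m1. \<exists>l2\<in>structure_vectors s m2.
        l2 \<in> zariski_closure (orbit s v l1) - orbit s v l1)"

definition has_only_proper_degeneration ::
  "('f::field \<Rightarrow> 'v::ab_group_add \<Rightarrow> 'v) \<Rightarrow> ('n::finite \<Rightarrow> 'v) \<Rightarrow>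
   ('v \<Rightarrow> 'v \<Rightarrow> 'v) \<Rightarrow> ('v \<Rightarrow> 'v \<Rightarrow> 'v) \<Rightarrow> bool" where
  "has_only_proper_degeneration s v m h \<longleftrightarrow>
     (\<forall>m'\<in>algebras s. properly_degenerates s v m m' \<longleftrightarrow> isomorphic s m' h)"


section \<open>The algebras \<open>\<aa>\<^sub>n\<close>, \<open>\<dd>\<^sub>n\<close> and \<open>\<ee>\<^sub>n(\<alpha>)\<close>\<close>

text \<open>The indices \<open>1\<close> and \<open>2\<close> are the two smallest elements of the index type.\<close>

definition ix1 :: "'n::{finite, linorder}" where
  "ix1 = Min UNIV"

definition ix2 :: "'n::{finite, linorder}" where
  "ix2 = Min (UNIV - {ix1})"

definition algebra_a :: "'v::ab_group_add \<Rightarrow> 'v \<Rightarrow> 'v" where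
  "algebra_a = (\<lambda>x y. 0)"

definition delta_vec :: "('f::field, 'n::{finite, linorder}) svec" where
  "delta_vec = (\<lambda>(i, j, k). if i = ix1 \<and> j = ix1 \<and> k = ix2 then 1 else 0)"

definition epsilon_vec :: "'f::field \<Rightarrow> ('f, 'n::{finite, linorder}) svec" where
  "epsilon_vec \<alpha> = (\<lambda>(i, j, k).
     if i = ix1 \<and> j = ix1 \<and> k = ix1 then 1
     else if i = ix1 \<and> j \<noteq> ix1 \<and> k = j then \<alpha>
     else if i \<noteq> ix1 \<and> j = ix1 \<and> k = i then 1 - \<alpha>
     else 0)"

definition algebra_d ::
  "('f::field \<Rightarrow> 'v::ab_group_add \<Rightarrow> 'v) \<Rightarrow> ('n::{finite, linorder} \<Rightarrow> 'v) \<Rightarrow> ('v \<Rightarrow> 'v \<Rightarrow> 'v)" where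
  "algebra_d s v = algebra_of s v delta_vec"

definition algebra_e ::
  "('f::field \<Rightarrow> 'v::ab_group_add \<Rightarrow> 'v) \<Rightarrow> ('n::{finite, linorder} \<Rightarrow> 'v) \<Rightarrow> 'f \<Rightarrow>
   ('v \<Rightarrow> 'v \<Rightarrow> 'v)" where
  "algebra_e s v \<alpha> = algebra_of s v (epsilon_vec \<alpha>)"

end

theory Submission
  imports Defs
begin

text \<open>
  Orbits are the sets of all structure vectors of an algebra. Rescaling a basis \<open>b\<close> to \<open>t\<^bsup>w i\<^esup> b\<^sub>i\<close> and
  letting \<open>t\<close> tend to \<open>0\<close> shows that the entries \<open>ijk\<close> with \<open>w i + w j = w k\<close> survive in the orbit
  closure, provided that all nonzero entries satisfy \<open>w k \<le> w i + w j\<close>.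

  Let the algebra be non-alternating with \<open>\<aa>\<^sub>n\<close> as its only proper degeneration; then none of its
  degenerations is nonzero and alternating. If \<open>x\<close> and \<open>[x, x]\<close> are independent for some \<open>x\<close>, the
  weights \<open>1, 2, 2, \<dots>\<close> give a degeneration to \<open>\<dd>\<^sub>n\<close>. Otherwise, if \<open>x\<close>, \<open>y\<close> and \<open>[x, y]\<close> were
  independent, the weights \<open>1, 1, 2, 2, \<dots>\<close> would give a nonzero alternating algebra. Hence \<open>[x, y]\<close>
  always lies in the span of \<open>x\<close> and \<open>y\<close>, and this forces \<open>[x, y] = f(x) y + g(y) x\<close> with linear
  forms \<open>f\<close>, \<open>g\<close>. If \<open>f\<close> did not vanish on the kernel of \<open>f + g\<close>, the weights \<open>0, 1, 1, \<dots>\<close> would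
  again give a nonzero alternating algebra; so \<open>f = \<alpha> (f + g)\<close> and the algebra is \<open>\<ee>\<^sub>n(\<alpha>)\<close>.

  Conversely, the orbits of \<open>\<dd>\<^sub>n\<close> and \<open>\<ee>\<^sub>n(\<alpha>)\<close> together with \<open>0\<close> are cut out by explicit quadratic
  and linear equations.
\<close>

section \<open>Zariski closure\<close>

lemma zariski_closureI:
  assumes "\<And>p. (\<forall>y\<in>Y. poly_eval p y = 0) \<Longrightarrow> poly_eval p x = 0"
  shows "x \<in> zariski_closure Y"
  using assms unfolding zariski_closure_def hull_def zariski_closed_def by blast

text \<open>A polynomial vanishing on the curve for all \<open>t \<noteq> 0\<close> vanishes at \<open>t = 0\<close>, the field being infinite.\<close>

lemma zariski_closure_monomial_curve:
  fixes c :: "'i \<Rightarrow> 'f::field"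
  assumes inf: "infinite (UNIV :: 'f set)"
    and Y: "\<And>t. t \<noteq> 0 \<Longrightarrow> (\<lambda>i. c i * t ^ e i) \<in> Y"
  shows "(\<lambda>i. if e i = 0 then c i else 0) \<in> zariski_closure Y"
proof (rule zariski_closureI)
  fix p :: "('i, 'f) mvpoly"
  assume p: "\<forall>y\<in>Y. poly_eval p y = 0"
  \<comment> \<open>Restricting \<open>p\<close> to the curve gives a univariate polynomial in
    \<open>t\<close>.\<close>
  define q where "q = (\<Sum>m\<in>Poly_Mapping.keys p. [:Poly_Mapping.lookup p m:] *
    (\<Prod>i\<in>Poly_Mapping.keys m. monom (c i) (e i) ^ Poly_Mapping.lookup m i))"
  have q: "poly q t = poly_eval p (\<lambda>i. c i * t ^ e i)" for t
    by (simp add: q_def poly_eval_def poly_sum poly_prod poly_monom)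
  have "poly q t = 0" if "t \<noteq> 0" for t
    using p Y[OF that] q by auto
  then have "UNIV - {0} \<subseteq> {t. poly q t = 0}"
    by auto
  moreover have "infinite (UNIV - {0 :: 'f})"
    using inf by simp
  ultimately have "infinite {t. poly q t = 0}"
    using infinite_super by blast
  then have "q = 0"
    using poly_roots_finite by blast
  then have "poly_eval p (\<lambda>i. c i * 0 ^ e i) = 0"
    using q[of 0] by simp
  \<comment> \<open>Since \<open>0 ^ 0 = 1\<close>, exactly the entries with exponent 0 survive at
    \<open>t = 0\<close>.\<close>
  moreover have "(\<lambda>i. c i * 0 ^ e i) = (\<lambda>i. if e i = 0 then c i else 0)"
    by (auto simp: power_0_left)
  ultimately show "poly_eval p (\<lambda>i. if e i = 0 then c i else 0) = 0"
    by simp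
qed

section \<open>Polynomial equations passing from a set to its closure\<close>

definition polynomial_map :: "(('i \<Rightarrow> 'f::field) \<Rightarrow> 'f) \<Rightarrow> bool" where
  "polynomial_map F \<longleftrightarrow> (\<exists>p. \<forall>x. poly_eval p x = F x)"

text \<open>The zero locus of \<open>F\<close> is closed, so it contains the closure of any set on
  which \<open>F\<close> vanishes. This is how the equations of an orbit reach its closure.\<close>

lemma zariski_closure_polynomial_map:
  assumes "polynomial_map F" and "\<And>y. y \<in> Y \<Longrightarrow> F y = 0" and "x \<in> zariski_closure Y"
  shows "F x = 0"
proof -
  obtain p where p: "\<And>x. poly_eval p x = F x"
    using assms(1) by (auto simp: polynomial_map_def)
  have "zariski_closed {x. F x = 0}"
    unfolding zariski_closed_def by (intro exI[of _ "{p}"]) (auto simp: p)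
  then have "zariski_closure Y \<subseteq> {x. F x = 0}"
    unfolding zariski_closure_def using assms(2) by (intro hull_minimal) auto
  then show ?thesis
    using assms(3) by auto
qed

text \<open>Monomials may cancel in \<open>p + q\<close>, so additivity of evaluation needs the sums
  to run over a common larger index set.\<close>

lemma poly_eval_superset:
  assumes "finite S" and "Poly_Mapping.keys p \<subseteq> S"
  shows "poly_eval p x = (\<Sum>t\<in>S. Poly_Mapping.lookup p t *
    (\<Prod>i\<in>Poly_Mapping.keys t. x i ^ Poly_Mapping.lookup t i))"
  unfolding poly_eval_def
  using assms by (intro sum.mono_neutral_left) (auto simp: in_keys_iff)

lemma poly_eval_add: "poly_eval (p + q) x = poly_eval p x + poly_eval q x"
proof -
  let ?S = "Poly_Mapping.keys p \<union> Poly_Mapping.keys q"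
  have fin: "finite ?S" by simp
  show ?thesis
    unfolding poly_eval_superset[OF fin Poly_Mapping.keys_add]
      poly_eval_superset[OF fin Un_upper1] poly_eval_superset[OF fin Un_upper2]
    by (simp add: lookup_add distrib_right sum.distrib)
qed

lemma polynomial_map_add:
  "polynomial_map F \<Longrightarrow> polynomial_map G \<Longrightarrow> polynomial_map (\<lambda>x. F x + G x)"
  unfolding polynomial_map_def by (metis poly_eval_add)

lemma polynomial_map_sum:
  "(\<And>k. k \<in> A \<Longrightarrow> polynomial_map (F k)) \<Longrightarrow> polynomial_map (\<lambda>x. \<Sum>k\<in>A. F k x)"
proof (induction A rule: infinite_finite_induct)
  case (insert k A)
  then show ?case
    by (simp add: polynomial_map_add)
\<comment> \<open>Empty and infinite index sets both give the sum 0, which the zero polynomial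
  represents.\<close>
qed (auto simp: polynomial_map_def poly_eval_def intro!: exI[of _ 0])

lemma polynomial_map_linear: "polynomial_map (\<lambda>x. c * x i)"
  unfolding polynomial_map_def
  by (intro exI[of _ "Poly_Mapping.single (Poly_Mapping.single i 1) c"])
    (auto simp: poly_eval_def)

lemma polynomial_map_quadratic: "polynomial_map (\<lambda>x. c * (x i * x j))"
proof (cases "i = j")
  case True
  then show ?thesis
    unfolding polynomial_map_def
    by (intro exI[of _ "Poly_Mapping.single (Poly_Mapping.single i 2) c"])
      (auto simp: poly_eval_def power2_eq_square)
next
  case False
  have keys: "Poly_Mapping.keys (Poly_Mapping.single i 1 + Poly_Mapping.single j (1::nat)) = {i, j}"
    using False by (auto simp: in_keys_iff lookup_add lookup_single when_def split: if_splits)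
  then show ?thesis
    using False unfolding polynomial_map_def
    by (intro exI[of _ "Poly_Mapping.single (Poly_Mapping.single i 1 + Poly_Mapping.single j 1) c"])
      (auto simp: poly_eval_def keys lookup_add lookup_single)
qed


section \<open>Bases and coordinates\<close>

locale based_space = vector_space s
  for s :: "'f::field \<Rightarrow> 'v::ab_group_add \<Rightarrow> 'v" +
  fixes v :: "'n::{finite, linorder} \<Rightarrow> 'v"
  assumes v: "ordered_basis s v"
begin

sublocale finite_dimensional_vector_space s "range v"
  using v by unfold_locales (auto simp: ordered_basis_def)

lemma sum_range_family:
  assumes "inj b"
  shows "(\<Sum>u\<in>range b. s (h u) u) = (\<Sum>i\<in>UNIV. s (h (b i)) (b i))"
  using assms by (simp add: sum.reindex)

text \<open>A repetition \<open>b i = b j\<close> would itself be a nontrivial relation, with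
  coefficients 1 and -1. An independent family with as many members as \<open>v\<close> spans by
  dimension.\<close>

lemma ordered_basis_iff:
  fixes b :: "'n \<Rightarrow> 'v"
  shows "ordered_basis s b \<longleftrightarrow> (\<forall>c. (\<Sum>i\<in>UNIV. s (c i) (b i)) = 0 \<longrightarrow> (\<forall>i. c i = 0))"
proof
  assume b: "ordered_basis s b"
  show "\<forall>c. (\<Sum>i\<in>UNIV. s (c i) (b i)) = 0 \<longrightarrow> (\<forall>i. c i = 0)"
  proof (intro allI impI)
    fix c :: "'n \<Rightarrow> 'f" and i
    assume "(\<Sum>i\<in>UNIV. s (c i) (b i)) = 0"
    moreover have inj: "inj b" and ind: "independent (range b)"
      using b by (auto simp: ordered_basis_def)
    ultimately have "(\<Sum>u\<in>range b. s (c (inv b u)) u) = 0"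
      by (simp add: sum.reindex)
    from independentD[OF ind _ _ this, of "b i"] show "c i = 0"
      using inj by simp
  qed
next
  assume b: "\<forall>c. (\<Sum>i\<in>UNIV. s (c i) (b i)) = 0 \<longrightarrow> (\<forall>i. c i = 0)"
  have inj: "inj b"
  proof (rule injI, rule ccontr)
    fix i j assume eq: "b i = b j" and ne: "i \<noteq> j"
    let ?c = "\<lambda>k. (if k = i then 1 else 0) + (if k = j then - 1 else (0::'f))"
    have "(\<Sum>k\<in>UNIV. s (?c k) (b k)) = 0"
      by (simp add: scale_left_distrib sum.distrib if_distrib[of "\<lambda>c. s c _"] eq cong: if_cong)
    then have "\<forall>i. ?c i = 0"
      using b[rule_format, of ?c] by blast
    then have "?c i = 0" ..
    then show False using ne by simp
  qed
  have ind: "independent (range b)"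
    unfolding dependent_finite[OF finite_imageI[OF finite_class.finite_UNIV]]
    using b by (auto simp: sum_range_family[OF inj])
  have "card (range b) = card (range v)"
    using inj v by (simp add: card_image ordered_basis_def)
  then have "UNIV \<subseteq> span (range b)"
    using ind by (intro card_ge_dim_independent) auto
  then show "ordered_basis s b"
    using inj ind by (auto simp: ordered_basis_def)
qed

text \<open>Complete the image of \<open>I\<close> to a basis as a set. By counting, there are as
  many new vectors as free indices, so a bijection labels them.\<close>

lemma extend_to_ordered_basis:
  assumes "inj_on b I" and "independent (b ` I)"
  obtains b' :: "'n \<Rightarrow> 'v" where "ordered_basis s b'" and "\<And>i. i \<in> I \<Longrightarrow> b' i = b i"
proof -
  let ?E = "extend_basis (b ` I)"
  have E: "b ` I \<subseteq> ?E" "independent ?E" "span ?E = UNIV"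
    using assms by (auto simp: extend_basis_superset independent_extend_basis)
  then have finE: "finite ?E"
    using finiteI_independent by blast
  have "card ?E = card (range v)"
    using E by (metis dim_UNIV dim_eq_card dim_span)
  then have cE: "card ?E = CARD('n)"
    using v by (simp add: card_image ordered_basis_def)
  have "card (?E - b ` I) = card (UNIV - I)"
    using E finE assms cE by (simp add: card_Diff_subset card_image finite_subset[of "b ` I"])
  then obtain h where h: "bij_betw h (UNIV - I) (?E - b ` I)"
    using finE by (metis bij_betw_iff_card finite_Diff finite_class.finite_UNIV)
  let ?b = "\<lambda>i. if i \<in> I then b i else h i"
  have "bij_betw ?b (I \<union> (UNIV - I)) (b ` I \<union> (?E - b ` I))"
    using h assms(1) by (intro bij_betw_disjoint_Un) (auto simp: bij_betw_def)
  then have "bij_betw ?b UNIV ?E"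
    using E(1) by (simp add: Un_absorb1)
  then have "ordered_basis s ?b"
    using E by (auto simp: bij_betw_def ordered_basis_def)
  then show ?thesis
    using that by simp
qed

lemma sum_coord:
  assumes "ordered_basis s b"
  shows "(\<Sum>i\<in>UNIV. s (coord s b x i) (b i)) = x"
proof -
  have "(\<Sum>u\<in>range b. s (representation (range b) x u) u) = x"
    using assms by (intro sum_representation_eq) (auto simp: ordered_basis_def)
  then show ?thesis
    using assms by (simp add: coord_def sum_range_family ordered_basis_def)
qed

lemma basis_coeffs_eq:
  fixes b :: "'n \<Rightarrow> 'v"
  assumes "ordered_basis s b" and "(\<Sum>i\<in>UNIV. s (c i) (b i)) = (\<Sum>i\<in>UNIV. s (c' i) (b i))"
  shows "c = c'"
proof -
  have "(\<Sum>i\<in>UNIV. s (c i - c' i) (b i)) = 0"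
    using assms(2) by (simp add: scale_left_diff_distrib sum_subtractf)
  then show ?thesis
    using assms(1)[unfolded ordered_basis_iff] by (auto dest!: spec[of _ "\<lambda>i. c i - c' i"])
qed

lemma coord_eqI:
  fixes b :: "'n \<Rightarrow> 'v"
  assumes "ordered_basis s b" and "x = (\<Sum>i\<in>UNIV. s (c i) (b i))"
  shows "coord s b x = c"
  using assms by (intro basis_coeffs_eq[OF assms(1)]) (simp add: sum_coord)

lemma coord_simps [simp]:
  fixes b :: "'n \<Rightarrow> 'v"
  assumes b: "ordered_basis s b"
  shows "coord s b (x + y) i = coord s b x i + coord s b y i"
    and "coord s b (x - y) i = coord s b x i - coord s b y i"
    and "coord s b (s c x) i = c * coord s b x i"
    and "coord s b 0 i = 0"
    and "coord s b (b j) i = (if i = j then 1 else 0)"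
proof -
  show "coord s b (x + y) i = coord s b x i + coord s b y i"
    by (subst coord_eqI[OF b, of _ "\<lambda>i. coord s b x i + coord s b y i"])
      (simp_all add: scale_left_distrib sum.distrib sum_coord b)
  show "coord s b (x - y) i = coord s b x i - coord s b y i"
    by (subst coord_eqI[OF b, of _ "\<lambda>i. coord s b x i - coord s b y i"])
      (simp_all add: scale_left_diff_distrib sum_subtractf sum_coord b)
  show "coord s b (s c x) i = c * coord s b x i"
    by (subst coord_eqI[OF b, of _ "\<lambda>i. c * coord s b x i"])
      (simp_all add: sum_coord b flip: scale_scale scale_sum_right)
  show "coord s b 0 i = 0"
    by (subst coord_eqI[OF b, of _ "\<lambda>i. 0"]) simp_all
  show "coord s b (b j) i = (if i = j then 1 else 0)"
    by (subst coord_eqI[OF b, of _ "\<lambda>i. if i = j then 1 else 0"])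
      (simp_all add: if_distrib[of "\<lambda>c. s c _"] cong: if_cong)
qed

lemma basis_nonzero:
  fixes b :: "'n \<Rightarrow> 'v"
  assumes "ordered_basis s b"
  shows "b i \<noteq> 0"
proof
  assume "b i = 0"
  then have "coord s b (b i) i = coord s b 0 i" by simp
  then show False using assms by simp
qed

lemma coord_sum:
  fixes b :: "'n \<Rightarrow> 'v"
  assumes b: "ordered_basis s b"
  shows "coord s b (\<Sum>i\<in>UNIV. s (c i) (b i)) = c"
  by (rule coord_eqI[OF b refl])

lemma ordered_basis_scale:
  fixes b :: "'n \<Rightarrow> 'v"
  assumes b: "ordered_basis s b" and "\<And>i. c i \<noteq> 0"
  shows "ordered_basis s (\<lambda>i. s (c i) (b i))"
  unfolding ordered_basis_iff
proof (intro allI impI)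
  fix d i assume "(\<Sum>i\<in>UNIV. s (d i) (s (c i) (b i))) = 0"
  then have "\<forall>i. d i * c i = 0"
    using b[unfolded ordered_basis_iff] by (auto dest!: spec[of _ "\<lambda>i. d i * c i"])
  then show "d i = 0" using assms(2)[of i] by auto
qed

text \<open>A combination of the new family with coefficients \<open>c\<close> has coordinates
  \<open>g *v c\<close> relative to \<open>v\<close>; hence independence of the family means that
  \<open>g\<close> has trivial kernel.\<close>

lemma ordered_basis_matrix_iff:
  fixes g :: "(('f, 'n) vec, 'n) vec"
  shows "ordered_basis s (\<lambda>j. \<Sum>i\<in>UNIV. s (g $ i $ j) (v i)) \<longleftrightarrow> invertible g"
proof -
  have eq: "(\<Sum>j\<in>UNIV. s (c j) (\<Sum>i\<in>UNIV. s (g $ i $ j) (v i)))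
      = (\<Sum>i\<in>UNIV. s ((g *v vec_lambda c) $ i) (v i))" for c :: "'n \<Rightarrow> 'f"
  proof -
    have "(\<Sum>j\<in>UNIV. s (c j) (\<Sum>i\<in>UNIV. s (g $ i $ j) (v i)))
      = (\<Sum>j\<in>UNIV. \<Sum>i\<in>UNIV. s (g $ i $ j * c j) (v i))"
      by (simp add: scale_sum_right mult.commute)
    also have "\<dots> = (\<Sum>i\<in>UNIV. s ((g *v vec_lambda c) $ i) (v i))"
      by (subst sum.swap) (simp add: matrix_vector_mult_def scale_sum_left)
    finally show ?thesis .
  qed
  have zero: "(\<Sum>i\<in>UNIV. s (d i) (v i)) = 0 \<longleftrightarrow> (\<forall>i. d i = 0)" for d :: "'n \<Rightarrow> 'f"
    using v[unfolded ordered_basis_iff] by auto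
  have "ordered_basis s (\<lambda>j. \<Sum>i\<in>UNIV. s (g $ i $ j) (v i)) \<longleftrightarrow>
      (\<forall>c. g *v vec_lambda c = 0 \<longrightarrow> vec_lambda c = 0)"
    unfolding ordered_basis_iff[where b = "\<lambda>j. \<Sum>i\<in>UNIV. s (g $ i $ j) (v i)"] eq zero
    by (simp add: vec_eq_iff)
  also have "\<dots> \<longleftrightarrow> (\<forall>x. g *v x = 0 \<longrightarrow> x = 0)"
    by (metis vec_lambda_eta)
  finally show ?thesis
    by (simp add: invertible_left_inverse matrix_left_invertible_ker)
qed

lemma ordered_basis_matrixE:
  assumes "ordered_basis s b"
  obtains g :: "(('f, 'n) vec, 'n) vec" where "invertible g" and "b = (\<lambda>j. \<Sum>i\<in>UNIV. s (g $ i $ j) (v i))"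
proof -
  let ?g = "\<chi> i j. coord s v (b j) i"
  have "b = (\<lambda>j. \<Sum>i\<in>UNIV. s (?g $ i $ j) (v i))"
    by (simp add: sum_coord[OF v])
  then show ?thesis
    using that assms ordered_basis_matrix_iff[of ?g] by auto
qed


section \<open>Structure vectors, isomorphism and degeneration\<close>

abbreviation svecs :: "('v \<Rightarrow> 'v \<Rightarrow> 'v) \<Rightarrow> ('f, 'n) svec set" where
  "svecs \<equiv> structure_vectors s"

lemma linearD:
  assumes "Vector_Spaces.linear s s \<phi>"
  shows "\<phi> (x + y) = \<phi> x + \<phi> y" and "\<phi> (s c x) = s c (\<phi> x)" and "\<phi> 0 = 0"
    and "\<phi> (\<Sum>i\<in>A. h i) = (\<Sum>i\<in>A. \<phi> (h i))"
proof -
  interpret module_hom s s \<phi>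
    using assms by (rule Vector_Spaces.linear.axioms(3))
  show "\<phi> (x + y) = \<phi> x + \<phi> y" "\<phi> (s c x) = s c (\<phi> x)" "\<phi> 0 = 0"
    "\<phi> (\<Sum>i\<in>A. h i) = (\<Sum>i\<in>A. \<phi> (h i))"
    by (rule add scale zero sum)+
qed

lemma linearI:
  "(\<And>x y. \<phi> (x + y) = \<phi> x + \<phi> y) \<Longrightarrow> (\<And>c x. \<phi> (s c x) = s c (\<phi> x)) \<Longrightarrow>
    Vector_Spaces.linear s s \<phi>"
  by (simp add: Vector_Spaces.linear_iff vector_space_axioms)

lemma algebra_bilinear:
  assumes "m \<in> algebras s"
  shows "m (x + y) z = m x z + m y z" and "m z (x + y) = m z x + m z y"
    and "m (s c x) z = s c (m x z)" and "m z (s c x) = s c (m z x)"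
    and "m (\<Sum>i\<in>A. h i) z = (\<Sum>i\<in>A. m (h i) z)" and "m z (\<Sum>i\<in>A. h i) = (\<Sum>i\<in>A. m z (h i))"
proof -
  have l: "Vector_Spaces.linear s s (\<lambda>y. m z y)" and r: "Vector_Spaces.linear s s (\<lambda>x. m x z)"
    using assms by (auto simp: algebras_def)
  show "m (x + y) z = m x z + m y z" "m (s c x) z = s c (m x z)" "m (\<Sum>i\<in>A. h i) z = (\<Sum>i\<in>A. m (h i) z)"
    by (fact linearD[OF r])+
  show "m z (x + y) = m z x + m z y" "m z (s c x) = s c (m z x)" "m z (\<Sum>i\<in>A. h i) = (\<Sum>i\<in>A. m z (h i))"
    by (fact linearD[OF l])+
qed

lemma algebra_expand:
  assumes m: "m \<in> algebras s" and b: "ordered_basis s b"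
  shows "m x y = (\<Sum>i\<in>UNIV. \<Sum>j\<in>UNIV. s (coord s b x i * coord s b y j) (m (b i) (b j)))"
proof -
  have right: "m z y = (\<Sum>j\<in>UNIV. s (coord s b y j) (m z (b j)))" for z
    by (subst sum_coord[OF b, of y, symmetric]) (simp only: algebra_bilinear[OF m])
  have "m x y = (\<Sum>i\<in>UNIV. s (coord s b x i) (m (b i) y))"
    by (subst sum_coord[OF b, of x, symmetric]) (simp only: algebra_bilinear[OF m])
  then show ?thesis
    by (simp add: right[of "b _"] scale_sum_right)
qed

lemma algebra_eqI:
  assumes "m1 \<in> algebras s" and "m2 \<in> algebras s" and "ordered_basis s b"
    and "\<And>i j. m1 (b i) (b j) = m2 (b i) (b j)"
  shows "m1 = m2"
  by (intro ext, subst algebra_expand[OF assms(1,3)], subst algebra_expand[OF assms(2,3)])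
    (simp add: assms(4))

lemma structure_vector_expand:
  "ordered_basis s b \<Longrightarrow> m (b i) (b j) = (\<Sum>k\<in>UNIV. s (structure_vector s b m (i, j, k)) (b k))"
  by (simp add: structure_vector_def sum_coord)

lemma structure_vector_eqI:
  fixes b :: "'n \<Rightarrow> 'v"
  assumes "ordered_basis s b" and "\<And>i j. m (b i) (b j) = (\<Sum>k\<in>UNIV. s (l (i, j, k)) (b k))"
  shows "structure_vector s b m = l"
  by (auto simp: structure_vector_def assms(2) coord_sum[OF assms(1)])

lemma algebra_of_in_algebras:
  assumes "ordered_basis s (b :: 'n \<Rightarrow> 'v)"
  shows "algebra_of s b l \<in> algebras s"
proof -
  let ?m = "algebra_of s b l"
  have "?m x (y + z) = ?m x y + ?m x z" "?m (y + z) x = ?m y x + ?m z x" for x y z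
    by (simp_all add: algebra_of_def assms distrib_left distrib_right scale_left_distrib sum.distrib)
  moreover have "?m x (s c y) = s c (?m x y)" "?m (s c y) x = s c (?m y x)" for c x y
    by (simp_all add: algebra_of_def assms scale_sum_right mult.assoc mult.left_commute[of _ c])
  ultimately show ?thesis
    by (auto simp: algebras_def intro: linearI)
qed

lemma algebra_of_basis:
  fixes b :: "'n \<Rightarrow> 'v"
  assumes b: "ordered_basis s b"
  shows "algebra_of s b l (b i) (b j) = (\<Sum>k\<in>UNIV. s (l (i, j, k)) (b k))"
proof -
  have "(\<Sum>k\<in>UNIV. s (coord s b (b i) i' * coord s b (b j) j' * l (i', j', k)) (b k)) =
    (if j' = j then if i' = i then \<Sum>k\<in>UNIV. s (l (i, j, k)) (b k) else 0 else 0)" for i' j'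
    by (simp add: b)
  then show ?thesis
    by (simp add: algebra_of_def)
qed

lemma structure_vector_algebra_of [simp]:
  "ordered_basis s (b :: 'n \<Rightarrow> 'v) \<Longrightarrow> structure_vector s b (algebra_of s b l) = l"
  by (rule structure_vector_eqI) (simp_all add: algebra_of_basis)

lemma algebra_of_structure_vector:
  assumes "m \<in> algebras s" and b: "ordered_basis s (b :: 'n \<Rightarrow> 'v)"
  shows "algebra_of s b (structure_vector s b m) = m"
  using assms by (intro algebra_eqI[of _ _ b] algebra_of_in_algebras)
    (simp_all add: algebra_of_basis flip: structure_vector_expand)

section \<open>Isomorphism read off from structure vectors\<close>

lemma isomorphic_sym:
  assumes "isomorphic s m1 m2"
  shows "isomorphic s m2 m1"
proof -
  obtain \<phi> where \<phi>: "Vector_Spaces.linear s s \<phi>" "bij \<phi>" "\<And>x y. \<phi> (m1 x y) = m2 (\<phi> x) (\<phi> y)"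
    using assms by (auto simp: isomorphic_def)
  have inv: "\<phi> (inv \<phi> x) = x" "inv \<phi> (\<phi> x) = x" for x
    using \<phi>(2) by (simp_all add: bij_def surj_f_inv_f)
  have "inv \<phi> (x + y) = inv \<phi> x + inv \<phi> y" "inv \<phi> (s c x) = s c (inv \<phi> x)"
    "inv \<phi> (m2 x y) = m1 (inv \<phi> x) (inv \<phi> y)" for c x y
    by (metis inv \<phi>(1) linearD(1)) (metis inv \<phi>(1) linearD(2), metis inv \<phi>(3))
  then show ?thesis
    unfolding isomorphic_def using \<phi>(2) by (intro exI[of _ "inv \<phi>"]) (auto intro: linearI bij_imp_bij_inv)
qed

text \<open>The image of a basis under an isomorphism is a basis with the same structure
  vector.\<close>

lemma isomorphic_imp_structure_vectors_subset:
  assumes "isomorphic s m1 m2"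
  shows "svecs m1 \<subseteq> svecs m2"
proof
  fix l assume "l \<in> svecs m1"
  then obtain b :: "'n \<Rightarrow> 'v" where b: "ordered_basis s b" and l: "l = structure_vector s b m1"
    by (auto simp: structure_vectors_def)
  obtain \<phi> where \<phi>: "Vector_Spaces.linear s s \<phi>" "bij \<phi>" "\<And>x y. \<phi> (m1 x y) = m2 (\<phi> x) (\<phi> y)"
    using assms by (auto simp: isomorphic_def)
  have \<phi>_sum: "(\<Sum>i\<in>UNIV. s (c i) (\<phi> (b i))) = \<phi> (\<Sum>i\<in>UNIV. s (c i) (b i))" for c
    by (simp add: linearD[OF \<phi>(1)])
  have b': "ordered_basis s (\<lambda>i. \<phi> (b i))"
    unfolding ordered_basis_iff \<phi>_sum
    using b \<phi>(2) linearD(3)[OF \<phi>(1)] unfolding ordered_basis_iff by (metis bij_is_inj injD)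
  have "structure_vector s (\<lambda>i. \<phi> (b i)) m2 = l"
  proof (rule structure_vector_eqI[OF b'])
    fix i j
    show "m2 (\<phi> (b i)) (\<phi> (b j)) = (\<Sum>k\<in>UNIV. s (l (i, j, k)) (\<phi> (b k)))"
      unfolding \<phi>_sum l structure_vector_expand[OF b, symmetric] by (simp add: \<phi>(3))
  qed
  then show "l \<in> svecs m2"
    using b' by (auto simp: structure_vectors_def)
qed

lemma isomorphic_imp_structure_vectors_eq:
  "isomorphic s m1 m2 \<Longrightarrow> svecs m1 = svecs m2"
  by (simp add: isomorphic_imp_structure_vectors_subset isomorphic_sym subset_antisym)

text \<open>The linear map matching the two bases is multiplicative on basis vectors, hence
  everywhere by bilinearity.\<close>

lemma common_structure_vector_imp_isomorphic:
  assumes m: "m1 \<in> algebras s" "m2 \<in> algebras s"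
    and l: "l \<in> svecs m1" "l \<in> svecs m2"
  shows "isomorphic s m1 m2"
proof -
  obtain b1 b2 :: "'n \<Rightarrow> 'v" where b: "ordered_basis s b1" "ordered_basis s b2"
    and l1: "l = structure_vector s b1 m1" and l2: "l = structure_vector s b2 m2"
    using l by (auto simp: structure_vectors_def)
  define \<phi> where "\<phi> x = (\<Sum>i\<in>UNIV. s (coord s b1 x i) (b2 i))" for x
  define \<psi> where "\<psi> x = (\<Sum>i\<in>UNIV. s (coord s b2 x i) (b1 i))" for x
  have \<phi>: "Vector_Spaces.linear s s \<phi>"
    unfolding \<phi>_def
    by (auto intro!: linearI simp: b scale_left_distrib sum.distrib scale_sum_right)
  have coord_\<phi>: "coord s b2 (\<phi> x) = coord s b1 x" for x
    by (simp add: \<phi>_def coord_sum b)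
  have "bij \<phi>"
    by (rule bij_betw_byWitness[where f' = \<psi>]) (auto simp: \<phi>_def \<psi>_def coord_sum sum_coord b)
  moreover have "\<phi> (m1 x y) = m2 (\<phi> x) (\<phi> y)" for x y
  proof -
    have "\<phi> (b1 i) = b2 i" for i
      by (simp add: \<phi>_def b if_distrib[of "\<lambda>c. s c _"] cong: if_cong)
    then have "\<phi> (m1 (b1 i) (b1 j)) = m2 (b2 i) (b2 j)" for i j
      unfolding structure_vector_expand[OF b(1), of m1] structure_vector_expand[OF b(2), of m2]
      by (simp add: linearD[OF \<phi>] flip: l1 l2)
    then show ?thesis
      unfolding algebra_expand[OF m(1) b(1), of x y] algebra_expand[OF m(2) b(2), of "\<phi> x"] coord_\<phi>
      by (simp add: linearD[OF \<phi>])
  qed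
  ultimately show ?thesis
    using \<phi> unfolding isomorphic_def by blast
qed

section \<open>Orbits and degenerations in terms of structure vectors\<close>

lemma structure_vector_in [intro]:
  "ordered_basis s b \<Longrightarrow> structure_vector s b m \<in> svecs m"
  by (auto simp: structure_vectors_def)

lemma algebra_of_v_mem: "l \<in> svecs (algebra_of s v l)"
  using structure_vector_in[OF v, of "algebra_of s v l"] by (simp add: v)

lemma orbit_eq_structure_vectors_algebra_of:
  "orbit s v l = svecs (algebra_of s v l)"
proof (intro equalityI subsetI)
  fix l' assume "l' \<in> svecs (algebra_of s v l)"
  then obtain b :: "'n \<Rightarrow> 'v" where "ordered_basis s b" "l' = structure_vector s b (algebra_of s v l)"
    by (auto simp: structure_vectors_def)
  then show "l' \<in> orbit s v l"
    by (auto simp: orbit_def act_def elim!: ordered_basis_matrixE)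
qed (auto simp: orbit_def act_def ordered_basis_matrix_iff)

lemma orbit_structure_vector:
  assumes "m \<in> algebras s" and "l \<in> svecs m"
  shows "orbit s v l = svecs m"
  unfolding orbit_eq_structure_vectors_algebra_of
  by (rule isomorphic_imp_structure_vectors_eq, rule common_structure_vector_imp_isomorphic)
    (fact algebra_of_in_algebras[OF v] assms algebra_of_v_mem)+

text \<open>All structure vectors of \<open>m1\<close> have the same orbit, so the choice of
  \<open>l1\<close> in the definition is immaterial.\<close>

lemma properly_degenerates_iff:
  assumes "m1 \<in> algebras s"
  shows "properly_degenerates s v m1 m2 \<longleftrightarrow>
    (\<exists>l\<in>svecs m2. l \<in> zariski_closure (svecs m1) - svecs m1)"
  using structure_vector_in[OF v, of m1]
  by (auto simp: properly_degenerates_def orbit_structure_vector[OF assms])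

lemma algebra_a_in_algebras: "algebra_a \<in> algebras s"
  by (auto simp: algebras_def algebra_a_def intro!: linearI)

lemma zero_structure_vector_iff:
  assumes "m \<in> algebras s"
  shows "(\<lambda>_. 0 :: 'f) \<in> svecs m \<longleftrightarrow> m = algebra_a"
proof
  assume "(\<lambda>_. 0) \<in> svecs m"
  then obtain b :: "'n \<Rightarrow> 'v" where b: "ordered_basis s b" "structure_vector s b m = (\<lambda>_. 0)"
    by (auto simp: structure_vectors_def)
  show "m = algebra_a"
    using b assms structure_vector_expand[OF b(1), of m]
    by (intro algebra_eqI[OF _ algebra_a_in_algebras b(1)]) (auto simp: algebra_a_def)
next
  assume "m = algebra_a"
  then have "structure_vector s v m = (\<lambda>_. 0)"
    using v by (intro structure_vector_eqI) (auto simp: algebra_a_def)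
  then show "(\<lambda>_. 0) \<in> svecs m"
    using structure_vector_in[OF v] by metis
qed

lemma isomorphic_algebra_a_iff:
  assumes "m \<in> algebras s"
  shows "isomorphic s m algebra_a \<longleftrightarrow> m = algebra_a"
  using isomorphic_imp_structure_vectors_eq[of m algebra_a]
    common_structure_vector_imp_isomorphic[OF assms algebra_a_in_algebras]
    zero_structure_vector_iff[OF assms] zero_structure_vector_iff[OF algebra_a_in_algebras]
  by auto

lemma structure_vector_closure_weights:
  fixes b :: "'n \<Rightarrow> 'v" and w :: "'n \<Rightarrow> nat"
  assumes inf: "infinite (UNIV :: 'f set)" and m: "m \<in> algebras s" and b: "ordered_basis s b"
    and w: "\<And>i j k. structure_vector s b m (i, j, k) \<noteq> 0 \<Longrightarrow> w k \<le> w i + w j"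
  shows "(\<lambda>(i, j, k). if w i + w j = w k then structure_vector s b m (i, j, k) else 0)
    \<in> zariski_closure (svecs m)"
proof -
  let ?l = "structure_vector s b m"
  \<comment> \<open>Rescaling multiplies the entry \<open>ijk\<close> by \<open>t\<close> to the
    power \<open>w i + w j - w k\<close>. By the assumption on \<open>w\<close> the truncated
    subtraction is exact at nonzero entries; at zero entries the exponent is irrelevant and set to
    0.\<close>
  let ?e = "\<lambda>(i, j, k). if ?l (i, j, k) = 0 then 0 else w i + w j - w k"
  have "(\<lambda>p. ?l p * t ^ ?e p) \<in> svecs m" if t: "t \<noteq> 0" for t
  proof -
    let ?b = "\<lambda>i. s (t ^ w i) (b i)"
    have b': "ordered_basis s ?b"
      by (rule ordered_basis_scale[OF b]) (use t in simp)
    have "structure_vector s ?b m = (\<lambda>p. ?l p * t ^ ?e p)"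
    proof (rule structure_vector_eqI[OF b'])
      fix i j
      have key: "t ^ (w i + w j) * ?l (i, j, k) = ?l (i, j, k) * t ^ ?e (i, j, k) * t ^ w k" for k
        using w[of i j k] by (auto simp flip: power_add)
      have "m (?b i) (?b j) = (\<Sum>k\<in>UNIV. s (t ^ (w i + w j) * ?l (i, j, k)) (b k))"
        by (simp add: algebra_bilinear[OF m] structure_vector_expand[OF b, of m i j] scale_sum_right
            power_add ac_simps)
      then show "m (?b i) (?b j) = (\<Sum>k\<in>UNIV. s (?l (i, j, k) * t ^ ?e (i, j, k)) (?b k))"
        by (simp only: key scale_scale)
    qed
    then show ?thesis
      using structure_vector_in[OF b', of m] by simp
  qed
  from zariski_closure_monomial_curve[OF inf this]
  have "(\<lambda>p. if ?e p = 0 then ?l p else 0) \<in> zariski_closure (svecs m)" .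
  moreover have "(\<lambda>p. if ?e p = 0 then ?l p else 0) =
      (\<lambda>(i, j, k). if w i + w j = w k then ?l (i, j, k) else 0)"
    using w by (force simp: fun_eq_iff)
  ultimately show ?thesis by simp
qed

text \<open>Every point \<open>l\<close> of the closure is a structure vector of
  \<open>algebra_of s v l\<close>, so proper degenerations amount to closure points outside the
  orbit. The zero point always lies in the closure.\<close>

lemma has_only_proper_degeneration_a_iff:
  assumes inf: "infinite (UNIV :: 'f set)" and m: "m \<in> algebras s" and "m \<noteq> algebra_a"
  shows "has_only_proper_degeneration s v m algebra_a \<longleftrightarrow>
    (\<forall>l \<in> zariski_closure (svecs m). l = (\<lambda>_. 0) \<or> l \<in> svecs m)"
    (is "?L \<longleftrightarrow> ?R")
proof
  assume L: ?L
  show ?R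
  proof (intro ballI disjCI)
    fix l assume "l \<in> zariski_closure (svecs m)" "l \<notin> svecs m"
    moreover have "l \<in> svecs (algebra_of s v l)"
      by (rule algebra_of_v_mem)
    ultimately have "properly_degenerates s v m (algebra_of s v l)"
      unfolding properly_degenerates_iff[OF m] by blast
    then have "algebra_of s v l = algebra_a"
      using L algebra_of_in_algebras[OF v, of l]
      by (simp add: has_only_proper_degeneration_def isomorphic_algebra_a_iff)
    then have "structure_vector s v (algebra_of s v l) = (\<lambda>_. 0)"
      using v by (intro structure_vector_eqI) (auto simp: algebra_a_def)
    then show "l = (\<lambda>_. 0)"
      by (simp add: v)
  qed
next
  assume R: ?R
  define z where "z = (\<lambda>_ :: 'n \<times> 'n \<times> 'n. 0 :: 'f)"
  \<comment> \<open>With all weights 1, \<open>w i + w j = w k\<close> never holds, so the limit is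
    zero.\<close>
  have z: "z \<in> zariski_closure (svecs m)"
    using structure_vector_closure_weights[OF inf m v, of "\<lambda>_. 1"]
    by (simp add: case_prod_unfold z_def)
  have z': "z \<in> svecs m' \<longleftrightarrow> m' = algebra_a" if "m' \<in> algebras s" for m'
    unfolding z_def by (rule zero_structure_vector_iff[OF that])
  have "properly_degenerates s v m m' \<longleftrightarrow> m' = algebra_a" if m': "m' \<in> algebras s" for m'
    unfolding properly_degenerates_iff[OF m] z'[OF m', symmetric]
    using R[folded z_def] z z'[OF m] assms(3) by (metis DiffD1 DiffD2 DiffI)
  then show ?L
    by (simp add: has_only_proper_degeneration_def isomorphic_algebra_a_iff)
qed


section \<open>Linear forms and adapted bases\<close>

abbreviation linear_form :: "('v \<Rightarrow> 'f) \<Rightarrow> bool" where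
  "linear_form \<equiv> Vector_Spaces.linear s (*)"

lemma linear_formI:
  "(\<And>x y. f (x + y) = f x + f y) \<Longrightarrow> (\<And>c x. f (s c x) = c * f x) \<Longrightarrow> linear_form f"
  by (simp add: Vector_Spaces.linear_iff vector_space_axioms vector_space_over_itself.vector_space_axioms)

lemma linear_formD:
  assumes "linear_form f"
  shows "f (x + y) = f x + f y" and "f (x - y) = f x - f y" and "f (s c x) = c * f x" and "f 0 = 0"
    and "f (\<Sum>i\<in>A. h i) = (\<Sum>i\<in>A. f (h i))"
proof -
  interpret module_hom s "(*)" f
    using assms by (rule Vector_Spaces.linear.axioms(3))
  show "f (x + y) = f x + f y" "f (x - y) = f x - f y" "f (s c x) = c * f x" "f 0 = 0"
    "f (\<Sum>i\<in>A. h i) = (\<Sum>i\<in>A. f (h i))"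
    by (rule add diff scale zero sum)+
qed

lemma linear_form_coord: "ordered_basis s (b :: 'n \<Rightarrow> 'v) \<Longrightarrow> linear_form (\<lambda>x. coord s b x i)"
  by (rule linear_formI) simp_all

lemma linear_form_exists:
  fixes c :: "'n \<Rightarrow> 'f"
  obtains f where "linear_form f" and "\<And>i. f (v i) = c i"
proof
  show "linear_form (\<lambda>x. \<Sum>i\<in>UNIV. coord s v x i * c i)"
    by (rule linear_formI) (simp_all add: v distrib_right sum.distrib sum_distrib_left mult.assoc)
  show "(\<Sum>i\<in>UNIV. coord s v (v j) i * c i) = c j" for j
    by (simp add: v if_distrib[of "\<lambda>x. x * _"] cong: if_cong)
qed

section \<open>Bases extending given vectors or adapted to a linear form\<close>

lemma mem_span_pair: "z \<in> span {x, y} \<longleftrightarrow> (\<exists>c d. z = s c x + s d y)"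
proof -
  have "z \<in> span {x, y} \<longleftrightarrow> (\<exists>c d. z - s c x = s d y)"
    by (auto simp: span_breakdown_eq[of _ x] span_singleton)
  then show ?thesis
    by (simp add: diff_eq_eq add.commute)
qed

lemma extend_one:
  assumes "x \<noteq> 0"
  obtains b :: "'n \<Rightarrow> 'v" where "ordered_basis s b" and "b i = x"
proof -
  have "independent ((\<lambda>_. x) ` {i})"
    using assms by simp
  then obtain b where "ordered_basis s b" "\<And>k. k \<in> {i} \<Longrightarrow> b k = x"
    using extend_to_ordered_basis[of "\<lambda>_. x" "{i}"] by blast
  then show ?thesis
    using that by simp
qed

lemma extend_two:
  assumes "x \<noteq> 0" and "y \<notin> span {x}" and "i \<noteq> j"
  obtains b :: "'n \<Rightarrow> 'v" where "ordered_basis s b" and "b i = x" and "b j = y"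
proof -
  let ?b = "\<lambda>k. if k = i then x else y"
  have im: "?b ` {i, j} = {y, x}"
    using assms(3) by auto
  have "y \<noteq> x"
    using assms(2) by (auto simp: span_base)
  then have inj: "inj_on ?b {i, j}"
    by (auto simp: inj_on_def)
  have ind: "independent (?b ` {i, j})"
    unfolding im using assms by (simp add: independent_insert)
  obtain b where "ordered_basis s b" "\<And>k. k \<in> {i, j} \<Longrightarrow> b k = ?b k"
    using extend_to_ordered_basis[OF inj ind] by blast
  then show ?thesis
    using that[of b] assms(3) by simp
qed

lemma extend_three:
  assumes "x \<noteq> 0" and "y \<notin> span {x}" and "z \<notin> span {x, y}" and "i \<noteq> j" and "k \<notin> {i, j}"
  obtains b :: "'n \<Rightarrow> 'v" where "ordered_basis s b" and "b i = x" and "b j = y" and "b k = z"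
proof -
  let ?b = "\<lambda>l. if l = i then x else if l = j then y else z"
  have im: "?b ` {i, j, k} = {z, y, x}"
    using assms(4,5) by auto
  have "y \<noteq> x" "z \<notin> {x, y}"
    using assms(2,3) by (auto simp: span_base)
  then have inj: "inj_on ?b {i, j, k}"
    by (auto simp: inj_on_def)
  have ind: "independent (?b ` {i, j, k})"
  proof -
    have "independent (insert y {x})"
      unfolding independent_insert[of y] using assms(1,2) by simp
    then have "independent (insert z {x, y})"
      unfolding independent_insert[of z] using assms(3) by (simp add: insert_commute)
    then show ?thesis
      unfolding im by (simp add: insert_commute)
  qed
  obtain b where "ordered_basis s b" "\<And>l. l \<in> {i, j, k} \<Longrightarrow> b l = ?b l"
    using extend_to_ordered_basis[OF inj ind] by blast
  then show ?thesis
    using that[of b] assms(4,5) by simp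
qed

text \<open>Each \<open>b i\<close> with \<open>i \<noteq> p\<close> is moved into the kernel of
  \<open>f\<close> by subtracting a multiple of \<open>b p\<close>; vectors already in the kernel
  stay put.\<close>

lemma ordered_basis_adapt_to_form:
  fixes b :: "'n \<Rightarrow> 'v"
  assumes b: "ordered_basis s b" and f: "linear_form f" and fb: "f (b p) = 1"
  obtains b' :: "'n \<Rightarrow> 'v" where "ordered_basis s b'"
    and "\<And>i. f (b' i) = (if i = p then 1 else 0)"
    and "b' p = b p" and "\<And>i. f (b i) = 0 \<Longrightarrow> b' i = b i"
proof -
  define b' where "b' i = b i - s (if i = p then 0 else f (b i)) (b p)" for i
  have "ordered_basis s b'"
    unfolding ordered_basis_iff
  proof (intro allI impI)
    fix c i
    assume 0: "(\<Sum>i\<in>UNIV. s (c i) (b' i)) = 0"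
    \<comment> \<open>\<open>D\<close> is the total multiple of \<open>b p\<close> subtracted in the
      relation. Independence of \<open>b\<close> gives \<open>c i = 0\<close> for
      \<open>i \<noteq> p\<close> and \<open>c p = D\<close>; as \<open>D\<close> has no
      contribution from \<open>p\<close>, it vanishes too.\<close>
    define D where "D = (\<Sum>i\<in>UNIV. c i * (if i = p then 0 else f (b i)))"
    have "(\<Sum>i\<in>UNIV. s (c i - (if i = p then D else 0)) (b i)) =
        (\<Sum>i\<in>UNIV. s (c i) (b i)) - s D (b p)"
      by (simp add: scale_left_diff_distrib sum_subtractf if_distrib[of "\<lambda>c. s c _"] cong: if_cong)
    also have "\<dots> = (\<Sum>i\<in>UNIV. s (c i) (b' i))"
      by (simp add: b'_def D_def scale_right_diff_distrib sum_subtractf scale_sum_left)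
    finally have "(\<Sum>i\<in>UNIV. s (c i - (if i = p then D else 0)) (b i)) = 0"
      using 0 by simp
    then have c: "c i = (if i = p then D else 0)" for i
      using b[unfolded ordered_basis_iff, rule_format, of "\<lambda>i. c i - (if i = p then D else 0)" i]
      by simp
    have "D = 0"
      unfolding D_def by (rule sum.neutral) (simp add: c)
    then show "c i = 0"
      by (simp add: c)
  qed
  moreover have "f (b' i) = (if i = p then 1 else 0)" for i
    by (simp add: b'_def linear_formD[OF f] fb)
  ultimately show ?thesis
    by (rule that) (simp_all add: b'_def)
qed


section \<open>The algebras \<open>\<dd>\<^sub>n\<close> and \<open>\<ee>\<^sub>n(\<alpha>)\<close> in terms of linear forms\<close>

text \<open>Coordinate-free shape of \<open>algebra_d\<close>, where \<open>f\<close> is the first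
  coordinate and \<open>w\<close> the second basis vector.\<close>

definition d_product :: "('v \<Rightarrow> 'f) \<Rightarrow> 'v \<Rightarrow> 'v \<Rightarrow> 'v \<Rightarrow> 'v" where
  "d_product f w = (\<lambda>x y. s (f x * f y) w)"

text \<open>For dimension at least 3 these are the bilinear products with \<open>[x, y]\<close>
  always in the span of \<open>x\<close> and \<open>y\<close>. The algebras \<open>algebra_e\<close>
  arise when both forms are multiples of one nonzero form, with factors adding up to 1.\<close>

definition form_product :: "('v \<Rightarrow> 'f) \<Rightarrow> ('v \<Rightarrow> 'f) \<Rightarrow> 'v \<Rightarrow> 'v \<Rightarrow> 'v" where
  "form_product a b = (\<lambda>x y. s (a x) y + s (b y) x)"

abbreviation e_product :: "'f \<Rightarrow> ('v \<Rightarrow> 'f) \<Rightarrow> 'v \<Rightarrow> 'v \<Rightarrow> 'v" where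
  "e_product \<alpha> f \<equiv> form_product (\<lambda>x. \<alpha> * f x) (\<lambda>x. (1 - \<alpha>) * f x)"

lemma d_product_in_algebras: "linear_form f \<Longrightarrow> d_product f w \<in> algebras s"
  by (auto simp: algebras_def d_product_def linear_formD scale_left_distrib algebra_simps intro!: linearI)

lemma form_product_in_algebras:
  "linear_form a \<Longrightarrow> linear_form b \<Longrightarrow> form_product a b \<in> algebras s"
  by (auto simp: algebras_def form_product_def linear_formD scale_left_distrib scale_right_distrib
      algebra_simps intro!: linearI)

lemma linear_form_scale: "linear_form f \<Longrightarrow> linear_form (\<lambda>x. c * f x)"
  by (rule linear_formI) (simp_all add: linear_formD distrib_left mult.left_commute)

lemma e_product_in_algebras: "linear_form f \<Longrightarrow> e_product \<alpha> f \<in> algebras s"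
  by (intro form_product_in_algebras linear_form_scale)

lemma structure_vector_form_product:
  assumes "ordered_basis s (b :: 'n \<Rightarrow> 'v)"
  shows "structure_vector s b (form_product f g) (i, j, k) =
    (if k = j then f (b i) else 0) + (if k = i then g (b j) else 0)"
  using assms by (simp add: structure_vector_def form_product_def)

lemma structure_vector_d_product:
  assumes "ordered_basis s (b :: 'n \<Rightarrow> 'v)"
  shows "structure_vector s b (d_product f w) (i, j, k) = f (b i) * f (b j) * coord s b w k"
  using assms by (simp add: structure_vector_def d_product_def)

text \<open>Normalise \<open>z\<close> to \<open>f z = 1\<close>. It is then independent of
  \<open>w\<close>, which lies in the kernel of \<open>f\<close>, so both extend to a basis;
  adapting this basis to \<open>f\<close> leaves them unchanged.\<close>

lemma delta_vec_in_svecs_d_product: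
  assumes f: "linear_form f" "f z \<noteq> 0" and w: "w \<noteq> 0" "f w = 0" and ix: "ix1 \<noteq> (ix2 :: 'n)"
  shows "delta_vec \<in> svecs (d_product f w)"
proof -
  let ?z = "s (inverse (f z)) z"
  have fz: "f ?z = 1"
    using f by (simp add: linear_formD)
  have "?z \<notin> span {w}"
  proof
    assume "?z \<in> span {w}"
    then obtain k where "?z = s k w"
      by (auto simp: span_singleton)
    then show False
      using fz w(2) linear_formD(3)[OF f(1), of k w] by simp
  qed
  then obtain b0 :: "'n \<Rightarrow> 'v" where b0: "ordered_basis s b0" "b0 ix2 = w" "b0 ix1 = ?z"
    using w(1) ix extend_two[of w ?z ix2 ix1] by metis
  obtain b :: "'n \<Rightarrow> 'v" where b: "ordered_basis s b" "\<And>i. f (b i) = (if i = ix1 then 1 else 0)"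
      "b ix2 = w"
    using ordered_basis_adapt_to_form[OF b0(1) f(1), of ix1] b0 w fz by metis
  have "structure_vector s b (d_product f w) = delta_vec"
    using b(1) by (auto simp: structure_vector_d_product delta_vec_def b(2) b(3)[symmetric])
  then show ?thesis
    using structure_vector_in[OF b(1)] by metis
qed

lemma epsilon_vec_in_svecs_e_product:
  assumes f: "linear_form f" "f z \<noteq> 0"
  shows "epsilon_vec \<alpha> \<in> svecs (e_product \<alpha> f)"
proof -
  let ?z = "s (inverse (f z)) z"
  have fz: "f ?z = 1"
    using f by (simp add: linear_formD)
  then have "?z \<noteq> 0"
    using linear_formD(4)[OF f(1)] by fastforce
  then obtain b0 :: "'n \<Rightarrow> 'v" where b0: "ordered_basis s b0" "b0 ix1 = ?z"
    by (rule extend_one)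
  obtain b :: "'n \<Rightarrow> 'v" where b: "ordered_basis s b" "\<And>i. f (b i) = (if i = ix1 then 1 else 0)"
    using ordered_basis_adapt_to_form[OF b0(1) f(1), of ix1] b0 fz by metis
  have "structure_vector s b (e_product \<alpha> f) = epsilon_vec \<alpha>"
    by (auto simp: structure_vector_form_product[OF b(1)] epsilon_vec_def b(2))
  then show ?thesis
    using structure_vector_in[OF b(1)] by metis
qed

lemma algebra_d_eq: "algebra_d s v = d_product (\<lambda>x. coord s v x ix1) (v ix2)"
proof -
  have "structure_vector s v (d_product (\<lambda>x. coord s v x ix1) (v ix2)) = delta_vec"
    by (auto simp: structure_vector_d_product delta_vec_def v)
  then show ?thesis
    unfolding algebra_d_def
    by (metis algebra_of_structure_vector v d_product_in_algebras linear_form_coord)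
qed

lemma algebra_e_eq: "algebra_e s v \<alpha> = e_product \<alpha> (\<lambda>x. coord s v x ix1)"
proof -
  have "structure_vector s v (e_product \<alpha> (\<lambda>x. coord s v x ix1)) = epsilon_vec \<alpha>"
    by (auto simp: structure_vector_form_product v epsilon_vec_def)
  then show ?thesis
    unfolding algebra_e_def
    by (metis algebra_of_structure_vector v e_product_in_algebras linear_form_coord)
qed

lemma algebra_d_in_algebras: "algebra_d s v \<in> algebras s"
  by (simp add: algebra_d_def algebra_of_in_algebras v)

lemma algebra_e_in_algebras: "algebra_e s v \<alpha> \<in> algebras s"
  by (simp add: algebra_e_def algebra_of_in_algebras v)

section \<open>Non-alternating and pairwise non-isomorphic\<close>

lemma algebra_d_not_alternating: "algebra_d s v \<notin> alternating_algebras s"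
  by (auto simp: alternating_algebras_def algebra_d_eq d_product_def v basis_nonzero intro!: exI[of _ "v ix1"])

lemma algebra_e_not_alternating: "algebra_e s v \<alpha> \<notin> alternating_algebras s"
proof
  assume "algebra_e s v \<alpha> \<in> alternating_algebras s"
  then have "algebra_e s v \<alpha> (v ix1) (v ix1) = 0"
    by (simp add: alternating_algebras_def)
  then have "s (\<alpha> + (1 - \<alpha>)) (v ix1) = 0"
    unfolding scale_left_distrib by (simp add: algebra_e_eq form_product_def v)
  then show False
    using basis_nonzero[OF v, of ix1] by simp
qed

text \<open>\<open>algebra_e\<close> has the nonzero idempotent \<open>v ix1\<close>. In
  \<open>algebra_d\<close> squares lie in the kernel of the form, so the square of a square is zero
  and the only idempotent is 0.\<close>

lemma algebra_d_not_isomorphic_e: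
  assumes ix: "ix1 \<noteq> (ix2 :: 'n)"
  shows "\<not> isomorphic s (algebra_d s v) (algebra_e s v \<alpha>)"
proof
  assume "isomorphic s (algebra_d s v) (algebra_e s v \<alpha>)"
  then obtain \<phi> where \<phi>: "Vector_Spaces.linear s s \<phi>" "bij \<phi>"
      "\<And>x y. \<phi> (algebra_d s v x y) = algebra_e s v \<alpha> (\<phi> x) (\<phi> y)"
    by (auto simp: isomorphic_def)
  obtain x where x: "\<phi> x = v ix1"
    using \<phi>(2) by (metis bij_pointE)
  have "algebra_e s v \<alpha> (v ix1) (v ix1) = s (\<alpha> + (1 - \<alpha>)) (v ix1)"
    unfolding scale_left_distrib by (simp add: algebra_e_eq form_product_def v)
  then have "\<phi> (algebra_d s v x x) = \<phi> x"
    by (simp add: \<phi>(3) x)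
  then have dx: "algebra_d s v x x = x"
    using \<phi>(2) by (metis bij_is_inj injD)
  have "algebra_d s v (algebra_d s v x x) (algebra_d s v x x) = 0"
    using ix by (simp add: algebra_d_eq d_product_def v)
  then have "\<phi> x = 0"
    unfolding dx using linearD(3)[OF \<phi>(1)] by simp
  then show False
    using x basis_nonzero[OF v] by metis
qed

text \<open>From \<open>[x, x] = f(x) x\<close> the form \<open>f\<close> is preserved by an
  isomorphism; the product of \<open>v ix1\<close> and \<open>v ix2\<close> then reveals the
  parameter.\<close>

lemma isomorphic_e_imp_eq:
  assumes ix: "ix1 \<noteq> (ix2 :: 'n)" and "isomorphic s (algebra_e s v \<alpha>) (algebra_e s v \<beta>)"
  shows "\<alpha> = \<beta>"
proof -
  let ?f = "\<lambda>x. coord s v x ix1"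
  obtain \<phi> where \<phi>: "Vector_Spaces.linear s s \<phi>" "bij \<phi>"
      "\<And>x y. \<phi> (algebra_e s v \<alpha> x y) = algebra_e s v \<beta> (\<phi> x) (\<phi> y)"
    using assms by (auto simp: isomorphic_def)
  have eq: "s (\<alpha> * ?f x) (\<phi> y) + s ((1 - \<alpha>) * ?f y) (\<phi> x) =
      s (\<beta> * ?f (\<phi> x)) (\<phi> y) + s ((1 - \<beta>) * ?f (\<phi> y)) (\<phi> x)" for x y
    using \<phi>(3)[of x y] by (simp add: algebra_e_eq form_product_def linearD[OF \<phi>(1)])
  have nz: "\<phi> (v i) \<noteq> 0" for i
    using \<phi>(2) basis_nonzero[OF v] linearD(3)[OF \<phi>(1)] by (metis bij_is_inj injD)
  have f\<phi>: "?f (\<phi> (v i)) = ?f (v i)" for i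
    using eq[of "v i" "v i"] nz[of i]
    by (simp add: algebra_simps flip: scale_left_distrib)
  show "\<alpha> = \<beta>"
    using eq[of "v ix1" "v ix2"] nz[of ix2] ix by (simp add: f\<phi> v)
qed


section \<open>Orbit closures of \<open>\<dd>\<^sub>n\<close> and \<open>\<ee>\<^sub>n(\<alpha>)\<close>\<close>

text \<open>The orbit consists of tensors \<open>f_i f_j w_k\<close> with \<open>f(w) = 0\<close>.
  Symmetry, rank-one minors and a trace condition hold on it, and any nonzero tensor satisfying
  these equations factors again in this way.\<close>

lemma svecs_algebra_d_closure:
  assumes ix: "ix1 \<noteq> (ix2 :: 'n)"
    and l: "l \<in> zariski_closure (svecs (algebra_d s v))" and nz: "l \<noteq> (\<lambda>_. 0)"
  shows "l \<in> svecs (algebra_d s v)"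
proof -
  \<comment> \<open>The two quadratic families are the 2x2 minors of the flattenings
    \<open>i | jk\<close> and \<open>ij | k\<close>.\<close>
  have orbit_eqs: "y (i, j, k) = y (j, i, k)"
    "y (i, j, k) * y (i', j', k') = y (i, j', k') * y (i', j, k)"
    "y (i, j, k) * y (i', j', k') = y (i, j, k') * y (i', j', k)"
    "(\<Sum>k\<in>UNIV. y (i, k, k)) = 0"
    if "y \<in> svecs (algebra_d s v)" for y i j k i' j' k'
  proof -
    obtain b :: "'n \<Rightarrow> 'v" where b: "ordered_basis s b" and "y = structure_vector s b (algebra_d s v)"
      using \<open>y \<in> svecs (algebra_d s v)\<close> by (auto simp: structure_vectors_def)
    then have y: "y (i, j, k) = coord s v (b i) ix1 * coord s v (b j) ix1 * coord s b (v ix2) k" for i j k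
      by (simp add: algebra_d_eq structure_vector_d_product)
    show "y (i, j, k) = y (j, i, k)"
      "y (i, j, k) * y (i', j', k') = y (i, j', k') * y (i', j, k)"
      "y (i, j, k) * y (i', j', k') = y (i, j, k') * y (i', j', k)"
      by (simp_all add: y)
    \<comment> \<open>This is the trace of left multiplication by \<open>b i\<close>, namely
      \<open>f(b i) f(w)\<close> with \<open>w = v ix2\<close> in the kernel of
      \<open>f\<close>.\<close>
    have "(\<Sum>k\<in>UNIV. y (i, k, k)) =
        coord s v (b i) ix1 * (\<Sum>k\<in>UNIV. coord s b (v ix2) k * coord s v (b k) ix1)"
      by (simp add: y sum_distrib_left ac_simps)
    also have "(\<Sum>k\<in>UNIV. coord s b (v ix2) k * coord s v (b k) ix1) =
        coord s v (\<Sum>k\<in>UNIV. s (coord s b (v ix2) k) (b k)) ix1"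
      by (simp add: linear_formD[OF linear_form_coord[OF v]])
    also have "\<dots> = 0"
      using ix by (simp add: sum_coord b v)
    finally show "(\<Sum>k\<in>UNIV. y (i, k, k)) = 0" by simp
  qed
  have diff: "polynomial_map (\<lambda>x. 1 * (x p * x q) + (- 1) * (x p' * x q'))" for p q p' q' :: "'n \<times> 'n \<times> 'n"
    by (intro polynomial_map_add polynomial_map_quadratic)
  have sym: "l (i, j, k) = l (j, i, k)" for i j k
    using zariski_closure_polynomial_map[OF
        polynomial_map_add[OF polynomial_map_linear[of 1 "(i, j, k)"] polynomial_map_linear[of "- 1" "(j, i, k)"]] _ l]
      orbit_eqs(1)[of _ i j k] by simp
  have rank: "l (i, j, k) * l (i', j', k') = l (i, j', k') * l (i', j, k)" for i j k i' j' k'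
    using zariski_closure_polynomial_map[OF diff _ l, of "(i, j, k)" "(i', j', k')" "(i, j', k')" "(i', j, k)"]
      orbit_eqs(2)[of _ i j k i' j' k'] by simp
  have rank': "l (i, j, k) * l (i', j', k') = l (i, j, k') * l (i', j', k)" for i j k i' j' k'
    using zariski_closure_polynomial_map[OF diff _ l, of "(i, j, k)" "(i', j', k')" "(i, j, k')" "(i', j', k)"]
      orbit_eqs(3)[of _ i j k i' j' k'] by simp
  have trace: "(\<Sum>k\<in>UNIV. l (i, k, k)) = 0" for i
  proof -
    have "(\<Sum>k\<in>UNIV. 1 * l (i, k, k)) = 0"
      by (rule zariski_closure_polynomial_map[OF _ _ l], intro polynomial_map_sum polynomial_map_linear)
        (simp add: orbit_eqs(4))
    then show ?thesis by simp
  qed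
  obtain p q r where "l (p, q, r) \<noteq> 0"
    using nz by (metis ext prod_cases3)
  \<comment> \<open>By symmetry and a minor, the square of \<open>l (p, q, r)\<close> is
    \<open>l (p, p, r) * l (q, q, r)\<close>.\<close>
  then have E: "l (p, p, r) \<noteq> 0"
    using rank[of p q r q p r] sym[of q p r] by auto
  define E where "E = l (p, p, r)"
  \<comment> \<open>With the pivot \<open>E\<close>, the factors are
    \<open>f_i = l (i, p, r) / E\<close> and \<open>w_k = l (p, p, k)\<close>.\<close>
  have l_eq: "l (i, j, k) = l (i, p, r) / E * (l (j, p, r) / E) * l (p, p, k)" for i j k
  proof -
    have "l (i, j, k) * E * E = l (i, j, r) * E * l (p, p, k)"
      using rank'[of i j k p p r] by (simp add: E_def)
    also have "l (i, j, r) * E = l (i, p, r) * l (j, p, r)"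
      using rank[of i j r p p r] sym[of p j r] by (simp add: E_def)
    finally show ?thesis
      using E by (simp add: E_def field_simps)
  qed
  obtain f where f: "linear_form f" "\<And>i. f (v i) = l (i, p, r) / E"
    using linear_form_exists[of "\<lambda>i. l (i, p, r) / E"] by blast
  let ?w = "\<Sum>k\<in>UNIV. s (l (p, p, k)) (v k)"
  \<comment> \<open>The factorisation turns \<open>f ?w\<close> into the trace of left
    multiplication by \<open>v p\<close>.\<close>
  have "f ?w = (\<Sum>k\<in>UNIV. l (p, k, k))"
    using E by (subst l_eq) (simp add: linear_formD[OF f(1)] f(2) E_def mult.commute)
  then have fw: "f ?w = 0"
    by (simp add: trace)
  have "coord s v ?w r \<noteq> 0"
    using E by (simp add: coord_sum v)
  then have w: "?w \<noteq> 0"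
    using v by force
  have fp: "f (v p) \<noteq> 0"
    using E by (simp add: f(2) E_def)
  have "structure_vector s v (d_product f ?w) (i, j, k) = l (i, j, k)" for i j k
    by (subst l_eq) (simp only: structure_vector_d_product[OF v] f(2) coord_sum[OF v])
  then have "structure_vector s v (d_product f ?w) = l"
    by (simp add: fun_eq_iff split_paired_All)
  then have "l \<in> svecs (d_product f ?w)"
    using structure_vector_in[OF v] by metis
  moreover have "delta_vec \<in> svecs (d_product f ?w)"
    by (rule delta_vec_in_svecs_d_product[OF f(1) fp w fw ix])
  moreover have "delta_vec \<in> svecs (algebra_d s v)"
    unfolding algebra_d_def by (rule algebra_of_v_mem)
  ultimately show ?thesis
    using common_structure_vector_imp_isomorphic[OF d_product_in_algebras[OF f(1)] algebra_d_in_algebras]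
      isomorphic_imp_structure_vectors_eq by blast
qed

text \<open>The structure vectors of the products \<open>\<alpha> f(x) y + (1 - \<alpha>) f(y) x\<close> form a linear subspace,
  since \<open>f\<close> is recovered from the diagonal entries \<open>iii\<close>.\<close>

lemma svecs_algebra_e_closure:
  assumes l: "l \<in> zariski_closure (svecs (algebra_e s v \<alpha>))" and nz: "l \<noteq> (\<lambda>_. 0)"
  shows "l \<in> svecs (algebra_e s v \<alpha>)"
proof -
  let ?c = "\<lambda>j k. if k = j then \<alpha> else 0" and ?d = "\<lambda>i k. if k = i then 1 - \<alpha> else 0"
  have "y (i, j, k) = ?c j k * y (i, i, i) + ?d i k * y (j, j, j)"
    if y: "y \<in> svecs (algebra_e s v \<alpha>)" for y and i j k :: 'n
  proof -
    obtain b :: "'n \<Rightarrow> 'v" where "ordered_basis s b" and "y = structure_vector s b (algebra_e s v \<alpha>)"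
      using y by (auto simp: structure_vectors_def)
    then show ?thesis
      by (simp add: algebra_e_eq structure_vector_form_product algebra_simps)
  qed
  note orbit_eq = this
  have l_eq: "l (i, j, k) = ?c j k * l (i, i, i) + ?d i k * l (j, j, j)" for i j k
  proof -
    have "1 * l (i, j, k) + (- ?c j k * l (i, i, i) + - ?d i k * l (j, j, j)) = 0"
    proof (rule zariski_closure_polynomial_map[OF _ _ l])
      show "polynomial_map (\<lambda>y. 1 * y (i, j, k) + (- ?c j k * y (i, i, i) + - ?d i k * y (j, j, j)))"
        by (intro polynomial_map_add polynomial_map_linear)
      show "1 * y (i, j, k) + (- ?c j k * y (i, i, i) + - ?d i k * y (j, j, j)) = 0"
        if "y \<in> svecs (algebra_e s v \<alpha>)" for y
        using orbit_eq[OF that, of i j k] by simp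
    qed
    moreover have "a = c * b + d * e" if "1 * a + (- c * b + - d * e) = 0" for a b c d e :: 'f
      using that by (simp add: algebra_simps)
    ultimately show ?thesis by blast
  qed
  obtain f where f: "linear_form f" "\<And>i. f (v i) = l (i, i, i)"
    using linear_form_exists[of "\<lambda>i. l (i, i, i)"] by blast
  have "\<exists>p. l (p, p, p) \<noteq> 0"
  proof (rule ccontr)
    assume "\<not> ?thesis"
    then have "l (i, j, k) = 0" for i j k
      by (subst l_eq) simp
    then show False
      using nz by (simp add: fun_eq_iff split_paired_All)
  qed
  then obtain p where "l (p, p, p) \<noteq> 0" ..
  then have fp: "f (v p) \<noteq> 0"
    by (simp add: f(2))
  have "structure_vector s v (e_product \<alpha> f) (i, j, k) = l (i, j, k)" for i j k
    by (subst l_eq) (simp add: structure_vector_form_product v f(2))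
  then have "structure_vector s v (e_product \<alpha> f) = l"
    by (simp add: fun_eq_iff split_paired_All)
  then have "l \<in> svecs (e_product \<alpha> f)"
    using structure_vector_in[OF v] by metis
  moreover have "epsilon_vec \<alpha> \<in> svecs (e_product \<alpha> f)"
    by (rule epsilon_vec_in_svecs_e_product[OF f(1) fp])
  moreover have "epsilon_vec \<alpha> \<in> svecs (algebra_e s v \<alpha>)"
    unfolding algebra_e_def by (rule algebra_of_v_mem)
  ultimately show ?thesis
    using common_structure_vector_imp_isomorphic[OF e_product_in_algebras[OF f(1)] algebra_e_in_algebras]
      isomorphic_imp_structure_vectors_eq by blast
qed


section \<open>Classification\<close>

text \<open>Pair the terms \<open>ij\<close> and \<open>ji\<close>. The diagonal is a separate
  assumption because in characteristic 2 antisymmetry does not make it vanish.\<close>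

lemma sum_antisymmetric:
  fixes g :: "'b \<Rightarrow> 'b \<Rightarrow> 'v"
  assumes "finite A" and "\<And>i. g i i = 0" and "\<And>i j. g i j + g j i = 0"
  shows "(\<Sum>i\<in>A. \<Sum>j\<in>A. g i j) = 0"
  using assms(1)
proof induction
  case (insert a A)
  have "(\<Sum>i\<in>insert a A. \<Sum>j\<in>insert a A. g i j) =
      g a a + (\<Sum>j\<in>A. g a j + g j a) + (\<Sum>i\<in>A. \<Sum>j\<in>A. g i j)"
    using insert.hyps by (simp add: sum.distrib algebra_simps)
  then show ?case
    using insert.IH by (simp add: assms)
qed simp

lemma alternating_if_basis:
  fixes b :: "'n \<Rightarrow> 'v"
  assumes m: "m \<in> algebras s" and b: "ordered_basis s b"
    and "\<And>i. m (b i) (b i) = 0" and "\<And>i j. m (b i) (b j) + m (b j) (b i) = 0"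
  shows "m \<in> alternating_algebras s"
proof -
  have "m x x = 0" for x
  proof -
    have "m x x = (\<Sum>i\<in>UNIV. \<Sum>j\<in>UNIV. s (coord s b x i * coord s b x j) (m (b i) (b j)))"
      by (rule algebra_expand[OF m b])
    also have "\<dots> = 0"
    proof (rule sum_antisymmetric)
      fix i j
      show "s (coord s b x i * coord s b x j) (m (b i) (b j)) +
          s (coord s b x j * coord s b x i) (m (b j) (b i)) = 0"
        by (simp add: mult.commute[of "coord s b x j"] assms(4) flip: scale_right_distrib)
    qed (simp_all add: assms)
    finally show ?thesis .
  qed
  then show ?thesis
    using m by (simp add: alternating_algebras_def)
qed

text \<open>The limit along the weights is alternating by \<open>diag\<close> and
  \<open>anti\<close>, so it cannot be a structure vector of the non-alternating \<open>m\<close>;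
  being in the closure, it must be zero. The entry \<open>pqr\<close> survives in the limit, hence
  is zero.\<close>

lemma alternating_limit_zero:
  fixes b :: "'n \<Rightarrow> 'v" and w :: "'n \<Rightarrow> nat"
  assumes inf: "infinite (UNIV :: 'f set)"
    and m: "m \<in> algebras s" "m \<notin> alternating_algebras s"
    and deg: "has_only_proper_degeneration s v m algebra_a" and b: "ordered_basis s b"
    and w: "\<And>i j k. structure_vector s b m (i, j, k) \<noteq> 0 \<Longrightarrow> w k \<le> w i + w j"
    and diag: "\<And>i k. w i + w i = w k \<Longrightarrow> structure_vector s b m (i, i, k) = 0"
    and anti: "\<And>i j k. w i + w j = w k \<Longrightarrow>
      structure_vector s b m (i, j, k) + structure_vector s b m (j, i, k) = 0"
    and eq: "w p + w q = w r"
  shows "structure_vector s b m (p, q, r) = 0"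
proof -
  define l where "l = (\<lambda>(i, j, k). if w i + w j = w k then structure_vector s b m (i, j, k) else 0)"
  have "m \<noteq> algebra_a"
    using m by (auto simp: alternating_algebras_def algebra_a_def)
  moreover have "l \<in> zariski_closure (svecs m)"
    unfolding l_def by (rule structure_vector_closure_weights[OF inf m(1) b w])
  ultimately have "l = (\<lambda>_. 0) \<or> l \<in> svecs m"
    using deg has_only_proper_degeneration_a_iff[OF inf m(1)] by blast
  moreover have "l \<notin> svecs m"
  proof
    assume "l \<in> svecs m"
    then obtain b' :: "'n \<Rightarrow> 'v" where b': "ordered_basis s b'" "l = structure_vector s b' m"
      by (auto simp: structure_vectors_def)
    have ld: "l (i, i, k) = 0" and la: "l (i, j, k) + l (j, i, k) = 0" for i j k
      using diag[of i k] anti[of i j k] by (auto simp: l_def add.commute)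
    have "m \<in> alternating_algebras s"
    proof (rule alternating_if_basis[OF m(1) b'(1)])
      fix i j
      show "m (b' i) (b' i) = 0"
        unfolding structure_vector_expand[OF b'(1), of m] b'(2)[symmetric] by (simp add: ld)
      show "m (b' i) (b' j) + m (b' j) (b' i) = 0"
        unfolding structure_vector_expand[OF b'(1), of m] b'(2)[symmetric]
        by (simp add: la flip: sum.distrib scale_left_distrib)
    qed
    then show False using m(2) by simp
  qed
  ultimately have "l (p, q, r) = 0"
    by simp
  then show ?thesis
    using eq by (simp add: l_def)
qed

lemma delta_vec_in_svecs:
  assumes inf: "infinite (UNIV :: 'f set)" and ix: "ix1 \<noteq> (ix2 :: 'n)"
    and m: "m \<in> algebras s"
    and deg: "has_only_proper_degeneration s v m algebra_a" and x: "m x x \<notin> span {x}"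
  shows "delta_vec \<in> svecs m"
proof -
  have "m 0 0 = 0"
    using algebra_bilinear(3)[OF m, of 0 0 0] by simp
  then have "x \<noteq> 0"
    using x by (auto simp: span_zero)
  then obtain b :: "'n \<Rightarrow> 'v" where b: "ordered_basis s b" "b ix1 = x" "b ix2 = m x x"
    using x ix extend_two[of x "m x x" ix1 ix2] by metis
  \<comment> \<open>No weight exceeds a sum of two weights. Only entries with
    \<open>i = j = ix1\<close> and \<open>k \<noteq> ix1\<close> survive, and \<open>b ix2\<close>
    was chosen as the square of \<open>b ix1\<close>.\<close>
  let ?w = "\<lambda>i :: 'n. if i = ix1 then 1 else 2 :: nat"
  have "structure_vector s b m (ix1, ix1, k) = (if k = ix2 then 1 else 0)" for k
    by (simp add: structure_vector_def b flip: b(3))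
  then have "(\<lambda>(i, j, k). if ?w i + ?w j = ?w k then structure_vector s b m (i, j, k) else 0) = delta_vec"
    using ix by (auto simp: delta_vec_def fun_eq_iff)
  then have "delta_vec \<in> zariski_closure (svecs m)"
    using structure_vector_closure_weights[OF inf m b(1), of ?w] by simp
  moreover have "delta_vec \<noteq> (\<lambda>_ :: 'n \<times> 'n \<times> 'n. 0 :: 'f)"
    by (auto simp: delta_vec_def fun_eq_iff intro!: exI[of _ ix1] exI[of _ ix2])
  moreover have "m \<noteq> algebra_a"
    using x by (auto simp: algebra_a_def span_zero)
  ultimately show ?thesis
    using deg has_only_proper_degeneration_a_iff[OF inf m] by blast
qed

lemma product_in_span_pair:
  assumes inf: "infinite (UNIV :: 'f set)"
    and ix: "ix1 \<noteq> (ix2 :: 'n)" and card: "CARD('n) \<ge> 3"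
    and m: "m \<in> algebras s" "m \<notin> alternating_algebras s"
    and deg: "has_only_proper_degeneration s v m algebra_a" and sq: "\<And>x. m x x \<in> span {x}"
  shows "m x y \<in> span {x, y}"
proof (rule ccontr)
  assume xy: "m x y \<notin> span {x, y}"
  have x: "x \<noteq> 0"
  proof
    assume "x = 0"
    then have "m x y = 0"
      using algebra_bilinear(3)[OF m(1), of 0 0 y] by simp
    then show False using xy by (simp add: span_zero)
  qed
  have y: "y \<notin> span {x}"
  proof
    assume "y \<in> span {x}"
    then obtain c where "y = s c x"
      by (auto simp: span_singleton)
    then have "m x y \<in> span {x}"
      using sq[of x] by (simp add: algebra_bilinear[OF m(1)] span_scale)
    then show False
      using xy span_mono[of "{x}" "{x, y}"] by auto
  qed
  have "card {ix1, ix2 :: 'n} < CARD('n)"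
    using card card_insert_le_m1[of 2 "{ix2 :: 'n}" ix1] by (simp add: ix)
  then obtain k3 :: 'n where k3: "k3 \<notin> {ix1, ix2}"
    by (metis UNIV_eq_I less_irrefl)
  obtain b :: "'n \<Rightarrow> 'v" where b: "ordered_basis s b" "b ix1 = x" "b ix2 = y" "b k3 = m x y"
    using extend_three[OF x y xy ix k3] by blast
  \<comment> \<open>The surviving entries have \<open>i\<close> and \<open>j\<close> in
    \<open>{ix1, ix2}\<close> and \<open>k\<close> outside; the entry with \<open>k = k3\<close> is
    1 by the choice of \<open>b k3\<close>.\<close>
  let ?w = "\<lambda>i :: 'n. if i = ix1 \<or> i = ix2 then 1 else 2 :: nat"
  have square_coord: "coord s b (m z z) k = 0" if "coord s b z k = 0" for z k
  proof -
    obtain c where "m z z = s c z"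
      using sq[of z] by (auto simp: span_singleton)
    then show ?thesis using that b(1) by simp
  qed
  have "structure_vector s b m (ix1, ix2, k3) = 0"
  proof (rule alternating_limit_zero[OF inf m deg b(1), of ?w])
    fix i k assume "?w i + ?w i = ?w k"
    then have "k \<noteq> i" by (auto split: if_splits)
    then show "structure_vector s b m (i, i, k) = 0"
      using square_coord[of "b i" k] b(1) by (simp add: structure_vector_def)
  next
    fix i j k assume "?w i + ?w j = ?w k"
    then have k: "k \<noteq> i" "k \<noteq> j" by (auto split: if_splits)
    \<comment> \<open>Polarisation: for \<open>k\<close> outside \<open>{i, j}\<close> the squares
      of \<open>b i\<close>, \<open>b j\<close> and \<open>b i + b j\<close> all have zero
      coordinate at \<open>k\<close>.\<close>
    have "m (b i + b j) (b i + b j) = m (b i) (b i) + m (b j) (b j) + (m (b i) (b j) + m (b j) (b i))"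
      by (simp add: algebra_bilinear[OF m(1)] algebra_simps)
    then have "coord s b (m (b i + b j) (b i + b j)) k =
        coord s b (m (b i) (b i)) k + coord s b (m (b j) (b j)) k +
        (structure_vector s b m (i, j, k) + structure_vector s b m (j, i, k))"
      using b(1) by (simp add: structure_vector_def)
    then show "structure_vector s b m (i, j, k) + structure_vector s b m (j, i, k) = 0"
      using k b(1) by (simp add: square_coord)
  qed (use k3 in auto)
  then have "coord s b (b k3) k3 = 0"
    by (simp add: structure_vector_def b)
  then show False
    using b(1) by simp
qed

text \<open>The coefficient of \<open>v j\<close> in \<open>[v i, v j]\<close> is independent of
  \<open>j \<noteq> i\<close> and defines \<open>f (v i)\<close>; \<open>g\<close> arises likewise
  on the other side. A third index ties the diagonal entry to their sum.\<close>

lemma form_product_if_in_span_pair: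
  assumes card: "CARD('n) \<ge> 3" and m: "m \<in> algebras s" and span: "\<And>x y. m x y \<in> span {x, y}"
  obtains f g where "linear_form f" and "linear_form g" and "m = form_product f g"
proof -
  define l where "l = structure_vector s v m"
  have other: "\<exists>k. k \<notin> {i, j}" for i j :: 'n
  proof -
    have "card {i, j} < CARD('n)"
      using card by (cases "i = j") auto
    then show ?thesis
      by (metis UNIV_eq_I less_irrefl)
  qed
  have coords: "\<exists>c d. \<forall>k. coord s v (m x y) k = c * coord s v x k + d * coord s v y k" for x y
  proof -
    obtain c d where "m x y = s c x + s d y"
      using span[of x y] by (auto simp: mem_span_pair)
    then show ?thesis
      using v by (intro exI[of _ c] exI[of _ d]) simp
  qed
  have l: "coord s v (m (v i) (v j)) k = l (i, j, k)" for i j k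
    by (simp add: l_def structure_vector_def)
  have off: "l (i, j, k) = 0" if "k \<noteq> i" "k \<noteq> j" for i j k
    using coords[of "v i" "v j"] that by (auto simp: l v)
  have left: "l (i, j, j) = l (i, k, k)" if d: "i \<noteq> j" "i \<noteq> k" for i j k
  proof (cases "j = k")
    case False
    obtain c e where ce: "\<And>p. coord s v (m (v i) (v j + v k)) p = c * coord s v (v i) p + e * coord s v (v j + v k) p"
      using coords by blast
    show ?thesis
      \<comment> \<open>The vector \<open>v j + v k\<close> has equal coordinates at
        \<open>j\<close> and \<open>k\<close>, so its product with \<open>v i\<close> does
        too.\<close>
      using ce[of j] ce[of k] d False by (simp add: algebra_bilinear[OF m] v l off)
  qed simp
  have right: "l (j, i, j) = l (k, i, k)" if d: "i \<noteq> j" "i \<noteq> k" for i j k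
  proof (cases "j = k")
    case False
    obtain c e where ce: "\<And>p. coord s v (m (v j + v k) (v i)) p = c * coord s v (v j + v k) p + e * coord s v (v i) p"
      using coords by blast
    show ?thesis
      using ce[of j] ce[of k] d False by (simp add: algebra_bilinear[OF m] v l off)
  qed simp
  have diag: "l (i, i, i) = l (i, k, k) + l (j, i, j)" if d: "i \<noteq> j" "i \<noteq> k" "j \<noteq> k" for i j k
  proof -
    obtain c e where ce: "\<And>p. coord s v (m (v i + v j) (v i + v k)) p =
        c * coord s v (v i + v j) p + e * coord s v (v i + v k) p"
      using coords by blast
    \<comment> \<open>The coordinates at \<open>i\<close>, \<open>j\<close>, \<open>k\<close> are
      \<open>c + e\<close>, \<open>c\<close>, \<open>e\<close>, so the first is the sum of the
      others.\<close>
    have "l (i, i, i) + l (j, i, i) + (l (i, k, i)) = l (j, i, j) + l (j, k, j) + (l (i, k, k) + l (j, k, k))"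
      using ce[of i] ce[of j] ce[of k] d by (simp add: algebra_bilinear[OF m] v l off algebra_simps)
    then show ?thesis
      using left[of j i k] right[of k i j] d by (simp add: algebra_simps)
  qed
  \<comment> \<open>Any index other than \<open>i\<close> serves, by \<open>left\<close> and
    \<open>right\<close>.\<close>
  define o' where "o' i = (SOME j. j \<noteq> i)" for i :: 'n
  have o': "o' i \<noteq> i" for i
    unfolding o'_def using other[of i i] by (metis (mono_tags) insertI1 someI_ex)
  obtain f where f: "linear_form f" "\<And>i. f (v i) = l (i, o' i, o' i)"
    using linear_form_exists[of "\<lambda>i. l (i, o' i, o' i)"] by blast
  obtain g where g: "linear_form g" "\<And>i. g (v i) = l (o' i, i, o' i)"
    using linear_form_exists[of "\<lambda>i. l (o' i, i, o' i)"] by blast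
  have "structure_vector s v (form_product f g) (i, j, k) = l (i, j, k)" for i j k
  proof -
    obtain h where h: "h \<notin> {i, o' i}"
      using other by blast
    have "l (i, i, i) = l (i, o' i, o' i) + l (o' i, i, o' i)"
      using diag[of i h "o' i"] right[of i h "o' i"] h o'[of i] by auto
    moreover have "l (i, j, j) = l (i, o' i, o' i)" "l (i, j, i) = l (o' j, j, o' j)" if "i \<noteq> j"
      using left[of i j "o' i"] right[of j i "o' j"] o'[of i] o'[of j] that by metis+
    ultimately show ?thesis
      by (auto simp: structure_vector_form_product v f g off)
  qed
  then have "structure_vector s v (form_product f g) = structure_vector s v m"
    by (simp add: l_def fun_eq_iff split_paired_All)
  then have "m = form_product f g"
    using m f(1) g(1) by (metis algebra_of_structure_vector form_product_in_algebras v)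
  then show ?thesis
    using that f(1) g(1) by blast
qed

lemma form_product_kernel:
  assumes inf: "infinite (UNIV :: 'f set)" and ix: "ix1 \<noteq> (ix2 :: 'n)"
    and fg: "linear_form f" "linear_form g"
    and alt: "form_product f g \<notin> alternating_algebras s"
    and deg: "has_only_proper_degeneration s v (form_product f g) algebra_a"
    and x: "f x + g x = 0"
  shows "f x = 0"
proof (cases "x = 0")
  case True
  then show ?thesis
    using linear_formD(4)[OF fg(1)] by simp
next
  case False
  then obtain b :: "'n \<Rightarrow> 'v" where b: "ordered_basis s b" "b ix1 = x"
    by (rule extend_one)
  \<comment> \<open>Nonzero entries have \<open>k = i\<close> or \<open>k = j\<close>, so the weight
    condition holds. Among the surviving ones, \<open>f x + g x = 0\<close> kills the diagonal entry
    at \<open>ix1\<close> and makes the rest antisymmetric.\<close>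
  let ?w = "\<lambda>i :: 'n. if i = ix1 then 0 else 1 :: nat"
  note sv = structure_vector_form_product[OF b(1)]
  have gx: "g x = - f x"
    using x by (simp add: eq_neg_iff_add_eq_0 add.commute)
  have "structure_vector s b (form_product f g) (ix1, ix2, ix2) = 0"
  proof (rule alternating_limit_zero[OF inf form_product_in_algebras[OF fg] alt deg b(1), of ?w])
    fix i j k
    show "?w k \<le> ?w i + ?w j" if "structure_vector s b (form_product f g) (i, j, k) \<noteq> 0"
      using that by (auto simp: sv split: if_splits)
    show "structure_vector s b (form_product f g) (i, i, k) = 0" if "?w i + ?w i = ?w k"
      using that x by (auto simp: sv b split: if_splits)
    show "structure_vector s b (form_product f g) (i, j, k) +
        structure_vector s b (form_product f g) (j, i, k) = 0" if "?w i + ?w j = ?w k"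
      using that by (auto simp: sv b gx split: if_splits)
  qed (use ix in auto)
  then show ?thesis
    using ix by (simp add: sv b)
qed

lemma classification:
  assumes inf: "infinite (UNIV :: 'f set)"
    and ix: "ix1 \<noteq> (ix2 :: 'n)" and card: "CARD('n) \<ge> 3"
    and m: "m \<in> algebras s" "m \<notin> alternating_algebras s"
    and deg: "has_only_proper_degeneration s v m algebra_a"
  shows "isomorphic s m (algebra_d s v) \<or> (\<exists>\<alpha>. isomorphic s m (algebra_e s v \<alpha>))"
proof (cases "\<forall>x. m x x \<in> span {x}")
  case False
  then have "delta_vec \<in> svecs m"
    using delta_vec_in_svecs[OF inf ix m(1) deg] by blast
  moreover have "delta_vec \<in> svecs (algebra_d s v)"
    unfolding algebra_d_def by (rule algebra_of_v_mem)
  ultimately show ?thesis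
    using common_structure_vector_imp_isomorphic[OF m(1) algebra_d_in_algebras] by blast
next
  case True
  then have "m x y \<in> span {x, y}" for x y
    using product_in_span_pair[OF inf ix card m deg] by blast
  then obtain f g where fg: "linear_form f" "linear_form g" and m_eq: "m = form_product f g"
    by (rule form_product_if_in_span_pair[OF card m(1)])
  \<comment> \<open>Since \<open>[x, x] = (f x + g x) x\<close>, the form \<open>f + g\<close>
    cannot vanish identically.\<close>
  obtain z where z: "f z + g z \<noteq> 0"
  proof (rule ccontr)
    assume "\<not> thesis"
    then have "m x x = 0" for x
      using that by (auto simp: m_eq form_product_def simp flip: scale_left_distrib)
    then show False
      using m by (simp add: alternating_algebras_def)
  qed
  define h where "h x = f x + g x" for x
  have h: "linear_form h"
    by (rule linear_formI) (simp_all add: h_def linear_formD[OF fg(1)] linear_formD[OF fg(2)] algebra_simps)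
  define \<alpha> where "\<alpha> = f z / h z"
  have f: "f x = \<alpha> * h x" for x
  proof -
    \<comment> \<open>Project \<open>x\<close> along \<open>z\<close> to the kernel of
      \<open>h\<close>, where \<open>f\<close> vanishes; so \<open>f\<close> is a multiple of
      \<open>h\<close>, with factor the ratio at \<open>z\<close>.\<close>
    let ?y = "x - s (h x / h z) z"
    have "h ?y = 0"
      using z by (simp add: linear_formD[OF h]) (simp add: h_def)
    then have "f ?y = 0"
      using form_product_kernel[OF inf ix fg] m(2) deg unfolding m_eq h_def by blast
    then show ?thesis
      by (simp add: linear_formD[OF fg(1)] \<alpha>_def mult.commute)
  qed
  have g: "g x = (1 - \<alpha>) * h x" for x
    using f[of x] by (simp add: h_def algebra_simps)
  have "m = e_product \<alpha> h"
    unfolding m_eq by (simp add: form_product_def f g)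
  moreover have "epsilon_vec \<alpha> \<in> svecs (e_product \<alpha> h)"
    using z by (intro epsilon_vec_in_svecs_e_product[OF h, of z]) (simp add: h_def)
  moreover have "epsilon_vec \<alpha> \<in> svecs (algebra_e s v \<alpha>)"
    unfolding algebra_e_def by (rule algebra_of_v_mem)
  ultimately show ?thesis
    using common_structure_vector_imp_isomorphic[OF m(1) algebra_e_in_algebras] by blast
qed

end

text \<open>With two indices at hand, the set whose minimum defines \<open>ix2\<close> is nonempty,
  so its minimum belongs to it.\<close>

lemma ix1_neq_ix2:
  assumes "CARD('n::{finite, linorder}) \<ge> 2"
  shows "ix1 \<noteq> (ix2 :: 'n)"
proof -
  have "\<not> UNIV \<subseteq> {ix1 :: 'n}"
    using assms card_mono[of "{ix1 :: 'n}" UNIV] by auto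
  then have "ix2 \<in> UNIV - {ix1 :: 'n}"
    unfolding ix2_def by (intro Min_in) auto
  then show ?thesis by simp
qed

theorem theorem1p2:
  fixes s :: "'f::field \<Rightarrow> 'v::ab_group_add \<Rightarrow> 'v"
    and v :: "'n::{finite, linorder} \<Rightarrow> 'v"
  assumes "vector_space s"
    and "ordered_basis s v"
    and "CARD('n) \<ge> 3"
    and "infinite (UNIV :: 'f set)"
  shows
    "algebra_d s v \<in> algebras s - alternating_algebras s \<and>
     (\<forall>\<alpha>. algebra_e s v \<alpha> \<in> algebras s - alternating_algebras s) \<and>
     (\<forall>\<alpha>. \<not> isomorphic s (algebra_d s v) (algebra_e s v \<alpha>)) \<and>
     (\<forall>\<alpha> \<beta>. \<alpha> \<noteq> \<beta> \<longrightarrow> \<not> isomorphic s (algebra_e s v \<alpha>) (algebra_e s v \<beta>)) \<and>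
     has_only_proper_degeneration s v (algebra_d s v) algebra_a \<and>
     (\<forall>\<alpha>. has_only_proper_degeneration s v (algebra_e s v \<alpha>) algebra_a) \<and>
     (\<forall>m \<in> algebras s - alternating_algebras s.
        has_only_proper_degeneration s v m algebra_a \<longrightarrow>
        isomorphic s m (algebra_d s v) \<or> (\<exists>\<alpha>. isomorphic s m (algebra_e s v \<alpha>)))"
proof -
  interpret based_space s v
    using assms by (simp add: based_space_def based_space_axioms_def)
  have ix: "ix1 \<noteq> (ix2 :: 'n)"
    using assms(3) by (intro ix1_neq_ix2) simp
  \<comment> \<open>Shows that the non-alternating \<open>algebra_d\<close> and
    \<open>algebra_e\<close> differ from \<open>algebra_a\<close>, as the closure criterion
    requires.\<close>
  have zero_alternating: "algebra_a \<in> alternating_algebras s"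
    using algebra_a_in_algebras by (simp add: alternating_algebras_def algebra_a_def)
  have "has_only_proper_degeneration s v (algebra_d s v) algebra_a"
    using has_only_proper_degeneration_a_iff[OF assms(4) algebra_d_in_algebras]
      svecs_algebra_d_closure[OF ix] zero_alternating algebra_d_not_alternating by metis
  moreover have "has_only_proper_degeneration s v (algebra_e s v \<alpha>) algebra_a" for \<alpha>
    using has_only_proper_degeneration_a_iff[OF assms(4) algebra_e_in_algebras]
      svecs_algebra_e_closure zero_alternating algebra_e_not_alternating by metis
  moreover have "isomorphic s m (algebra_d s v) \<or> (\<exists>\<alpha>. isomorphic s m (algebra_e s v \<alpha>))"
    if "m \<in> algebras s - alternating_algebras s" "has_only_proper_degeneration s v m algebra_a" for m
    using classification[OF assms(4) ix assms(3)] that by simp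
  ultimately show ?thesis
    using isomorphic_e_imp_eq[OF ix]
    by (auto simp: algebra_d_in_algebras algebra_d_not_alternating algebra_e_in_algebras
        algebra_e_not_alternating algebra_d_not_isomorphic_e[OF ix])
qed

end
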